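(* Let $p$ be a prime. There is a constant $C$ (depending at most on $p$) such that for every $n\ge1$, every bilinear circuit over $GF(p)$ that computes the product of two $n\times n$ matrices has at least $\left(2.5+\frac{1.5}{p^3-1}\right)n^2 - Cn^{7/4}$ product gates.
   Context: The inputs are two $n\times n$ matrices of variables $x,y$ and the outputs are the $n^2$ entries $(x\cdot y)_{i,j}=\sum_{k}x_{i,k}y_{k,j}$. An arithmetic circuit over a field is a directed acyclic graph whose in-degree-0 nodes are input variables, edges carry field constants, and other nodes are sum or product gates. A bilinear circuit is an arithmetic circuit in which every product gate multiplies a linear form in the variables of $x$ only by a linear form in the variables of $y$ only. *)

theory Defs
  imports Complex_Main "HOL-Library.Poly_Mapping" "HOL-Library.Cardinality"
    "HOL-Computational_Algebra.Primes"
begin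

text \<open>
  Multivariate polynomials over \<open>'a\<close> in the variables \<open>'z\<close>, as finitely supported functions
  from monomials to coefficients. Circuits compute these formal polynomials, not the functions
  they induce, which over a finite field carry less information.
\<close>

type_synonym ('z, 'a) polynomial = "('z \<Rightarrow>\<^sub>0 nat) \<Rightarrow>\<^sub>0 'a"

definition pconst :: "'a \<Rightarrow> ('z, 'a::comm_ring_1) polynomial"
  where "pconst c = Poly_Mapping.single 0 c"

definition pvar :: "'z \<Rightarrow> ('z, 'a::comm_ring_1) polynomial"
  where "pvar z = Poly_Mapping.single (Poly_Mapping.single z 1) 1"

datatype 'z gate = Input 'z | Sum_Gate | Prod_Gate

text \<open>
  The directed edges are stored at their heads: \<open>(c, u)\<close> in \<open>in_edges C v\<close> is an edge from
  \<open>u\<close> to \<open>v\<close> carrying the constant \<open>c\<close>. Using lists admits parallel edges, as needed for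
  squaring; the order of the list is irrelevant to the polynomial computed.
\<close>

record ('v, 'z, 'a) circuit =
  nodes :: "'v set"
  label :: "'v \<Rightarrow> 'z gate"
  in_edges :: "'v \<Rightarrow> ('a \<times> 'v) list"

definition edge_rel :: "('v, 'z, 'a) circuit \<Rightarrow> ('v \<times> 'v) set"
  where "edge_rel C = {(u, v). v \<in> nodes C \<and> u \<in> snd ` set (in_edges C v)}"

definition arithmetic_circuit :: "'z set \<Rightarrow> ('v, 'z, 'a) circuit \<Rightarrow> bool"
  where "arithmetic_circuit Z C \<longleftrightarrow>
    finite (nodes C) \<and>
    edge_rel C \<subseteq> nodes C \<times> nodes C \<and>
    acyclic (edge_rel C) \<and>
    (\<forall>v\<in>nodes C. if in_edges C v = [] then label C v \<in> Input ` Z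
                  else label C v \<in> {Sum_Gate, Prod_Gate})"

definition gate_poly ::
    "('v, 'z, 'a::comm_ring_1) circuit \<Rightarrow> ('v \<Rightarrow> ('z, 'a) polynomial) \<Rightarrow> 'v \<Rightarrow> ('z, 'a) polynomial"
  where "gate_poly C f v = (case label C v of
      Input z \<Rightarrow> pvar z
    | Sum_Gate \<Rightarrow> (\<Sum>(c, u)\<leftarrow>in_edges C v. pconst c * f u)
    | Prod_Gate \<Rightarrow> (\<Prod>(c, u)\<leftarrow>in_edges C v. pconst c * f u))"

text \<open>
  The polynomial computed at a node, by recursion along the acyclic edge relation; the
  recursion equation is \<open>node_poly_eq\<close> below.
\<close>

definition node_poly :: "('v, 'z, 'a::comm_ring_1) circuit \<Rightarrow> 'v \<Rightarrow> ('z, 'a) polynomial"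
  where "node_poly C = wfrec (edge_rel C) (gate_poly C)"

lemma wf_edge_rel:
  assumes "arithmetic_circuit Z C"
  shows "wf (edge_rel C)"
proof (rule finite_acyclic_wf)
  show "finite (edge_rel C)"
    using assms unfolding arithmetic_circuit_def by (meson finite_SigmaI finite_subset)
  show "acyclic (edge_rel C)"
    using assms unfolding arithmetic_circuit_def by blast
qed

lemma node_poly_eq:
  assumes "arithmetic_circuit Z C" and "v \<in> nodes C"
  shows "node_poly C v = gate_poly C (node_poly C) v"
proof -
  have cut: "cut (node_poly C) (edge_rel C) v u = node_poly C u"
    if "(c, u) \<in> set (in_edges C v)" for c u
    using that assms(2) by (force simp: cut_def edge_rel_def)
  have map_eq: "map (\<lambda>(c, u). pconst c * cut (node_poly C) (edge_rel C) v u) (in_edges C v) =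
      map (\<lambda>(c, u). pconst c * node_poly C u) (in_edges C v)"
    by (rule map_cong) (auto simp: cut)
  have "node_poly C v = gate_poly C (cut (node_poly C) (edge_rel C) v) v"
    unfolding node_poly_def by (rule wfrec[OF wf_edge_rel[OF assms(1)]])
  also have "\<dots> = gate_poly C (node_poly C) v"
    unfolding gate_poly_def map_eq ..
  finally show ?thesis .
qed

definition num_product_gates :: "('v, 'z, 'a) circuit \<Rightarrow> nat"
  where "num_product_gates C = card {v \<in> nodes C. label C v = Prod_Gate}"

definition linear_form :: "'z set \<Rightarrow> ('z, 'a::comm_ring_1) polynomial \<Rightarrow> bool"
  where "linear_form Z P \<longleftrightarrow> (\<exists>a. P = (\<Sum>z\<in>Z. pconst (a z) * pvar z))"

datatype matrix_var = X nat nat | Y nat nat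

definition x_vars :: "nat \<Rightarrow> matrix_var set"
  where "x_vars n = {X i j |i j. i < n \<and> j < n}"

definition y_vars :: "nat \<Rightarrow> matrix_var set"
  where "y_vars n = {Y i j |i j. i < n \<and> j < n}"

text \<open>The factors of a product gate include the constants on its incoming edges.\<close>

definition bilinear_circuit :: "nat \<Rightarrow> ('v, matrix_var, 'a::comm_ring_1) circuit \<Rightarrow> bool"
  where "bilinear_circuit n C \<longleftrightarrow>
    arithmetic_circuit (x_vars n \<union> y_vars n) C \<and>
    (\<forall>v\<in>nodes C. label C v = Prod_Gate \<longrightarrow>
      (\<exists>P Q. map (\<lambda>(c, u). pconst c * node_poly C u) (in_edges C v) = [P, Q] \<and>
        (linear_form (x_vars n) P \<and> linear_form (y_vars n) Q \<or>
         linear_form (y_vars n) P \<and> linear_form (x_vars n) Q)))"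

definition computes_matrix_product :: "nat \<Rightarrow> ('v, matrix_var, 'a::comm_ring_1) circuit \<Rightarrow> bool"
  where "computes_matrix_product n C \<longleftrightarrow>
    (\<forall>i<n. \<forall>j<n. \<exists>v\<in>nodes C. node_poly C v = (\<Sum>k<n. pvar (X i k) * pvar (Y k j)))"

end

theory Submission
  imports Defs "Jordan_Normal_Form.Determinant"
begin

text \<open>
  A bilinear circuit with \<open>m\<close> product gates turns every linear combination of the outputs, given by an
  \<open>n \<times> n\<close> matrix \<open>A\<close>, into a vector of \<open>m\<close> coefficients; this is a linear code of dimension \<open>n\<^sup>2\<close>.
  If the Koszul flattening of a triple \<open>A\<^sub>0, A\<^sub>1, A\<^sub>2\<close> has rank \<open>R\<close>, then at least \<open>n R / 2\<close> products
  occur in the three combinations, because the flattening of a triple of multiples of one rank one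
  matrix has rank two.

  Over \<open>GF(p)\<close> there is an explicit linear family of matrices, parametrised by the polynomials
  of degree less than \<open>k\<close>, in which every independent triple has flattening rank \<open>3n - O(k)\<close>. This
  property of the family is the nonvanishing of a product of at most \<open>p\<^bsup>3k\<^esup>\<close> determinants of order at
  most \<open>3n\<close>, and a polynomial of degree \<open>D\<close> that does not vanish at a point does not vanish at some
  truncation of that point to \<open>D\<close> coordinates. Taking the coordinates from an information set of
  the code, one may therefore assume that the family involves none of \<open>n\<^sup>2 - 3n p\<^bsup>3k\<^esup>\<close> products.
  Each remaining product is missed by a fraction of at least \<open>p\<^sup>-\<^sup>3\<close> of all triples, whereas an independent
  triple meets about \<open>1.5 n\<^sup>2\<close> products, and only a fraction \<open>O(p\<^sup>-\<^sup>k)\<close> of the triples is dependent.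
  Hence there are about \<open>1.5 n\<^sup>2 p\<^sup>3 / (p\<^sup>3 - 1)\<close> remaining products, and the choice
  \<open>p\<^sup>k \<approx> n\<^bsup>1/4\<^esup>\<close> balances the errors.
\<close>

section \<open>Linear systems over a finite field\<close>

text \<open>Pigeonhole: over a finite field there are more vectors of unknowns than possible
  right-hand sides, and the difference of two vectors with the same image is a solution.\<close>

lemma underdetermined_system:
  fixes M :: "'e \<Rightarrow> 'i \<Rightarrow> 'a::field"
  assumes F: "finite (UNIV :: 'a set)" and E: "finite E" and I: "finite I" and less: "card E < card I"
  shows "\<exists>u. (\<exists>i\<in>I. u i \<noteq> 0) \<and> (\<forall>e\<in>E. (\<Sum>i\<in>I. M e i * u i) = 0)"
proof -
  let ?f = "\<lambda>u. restrict (\<lambda>e. \<Sum>i\<in>I. M e i * u i) E"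
  let ?A = "I \<rightarrow>\<^sub>E (UNIV :: 'a set)" and ?B = "E \<rightarrow>\<^sub>E (UNIV :: 'a set)"
  \<comment> \<open>Powers increase strictly with the exponent only for a base above 1;
    \<open>0\<close> and \<open>1\<close> supply two elements.\<close>
  have "card {0, 1 :: 'a} \<le> CARD('a)"
    using F by (intro card_mono) auto
  then have "CARD('a) \<ge> 2" by simp
  then have "card ?B < card ?A"
    using E I less by (simp add: card_PiE power_strict_increasing)
  moreover have "?f ` ?A \<subseteq> ?B" by auto
  moreover have "finite ?B" using E F by (simp add: finite_PiE)
  ultimately have "\<not> inj_on ?f ?A"
    using card_inj_on_le[of ?f ?A ?B] by linarith
  then obtain u v where uv: "u \<in> ?A" "v \<in> ?A" "?f u = ?f v" "u \<noteq> v"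
    by (auto simp: inj_on_def)
  from uv(1,2,4) have "\<exists>i\<in>I. u i - v i \<noteq> 0"
    by (metis PiE_ext eq_iff_diff_eq_0)
  moreover have "(\<Sum>i\<in>I. M e i * (u i - v i)) = 0" if "e \<in> E" for e
    using fun_cong[OF uv(3), of e] that by (simp add: right_diff_distrib sum_subtractf)
  ultimately show ?thesis by (intro exI[of _ "\<lambda>i. u i - v i"]) blast
qed

text \<open>A minimal set \<open>T\<close> of rows that still has trivial kernel works. Dropping the
  row \<open>s\<close> admits a nonzero vector killed by all other rows of \<open>T\<close>; scaled,
  it is the dual vector \<open>b s\<close>. Subtracting from \<open>v\<close> its expansion in the
  dual vectors leaves a vector in the trivial kernel.\<close>

lemma information_set:
  fixes G :: "'l \<Rightarrow> 'i \<Rightarrow> 'a::field"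
  assumes F: "finite (UNIV :: 'a set)" and L: "finite L" and I: "finite I"
    and inj: "\<forall>u. (\<forall>l\<in>L. (\<Sum>i\<in>I. G l i * u i) = 0) \<longrightarrow> (\<forall>i\<in>I. u i = 0)"
  shows "\<exists>T b. T \<subseteq> L \<and> card I \<le> card T \<and>
    (\<forall>s\<in>T. \<forall>t\<in>T. (\<Sum>i\<in>I. G t i * b s i) = (if t = s then 1 else 0)) \<and>
    (\<forall>v. \<forall>i\<in>I. v i = (\<Sum>t\<in>T. (\<Sum>j\<in>I. G t j * v j) * b t i))"
proof -
  define P where "P T \<longleftrightarrow> T \<subseteq> L \<and>
    (\<forall>u. (\<forall>l\<in>T. (\<Sum>i\<in>I. G l i * u i) = 0) \<longrightarrow> (\<forall>i\<in>I. u i = 0))" for T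
  have "P L" using inj unfolding P_def by blast
  then obtain T where T: "P T" and least: "\<And>S. P S \<Longrightarrow> card T \<le> card S"
    using ex_has_least_nat[of P L card] by blast
  have TL: "T \<subseteq> L" and injT: "\<And>u. \<forall>l\<in>T. (\<Sum>i\<in>I. G l i * u i) = 0 \<Longrightarrow> \<forall>i\<in>I. u i = 0"
    using T unfolding P_def by blast+
  have finT: "finite T" using TL L finite_subset by blast
  have card: "card I \<le> card T"
    using underdetermined_system[OF F finT I, of G] injT by (meson linorder_not_less)
  have "\<exists>u. \<forall>t\<in>T. (\<Sum>i\<in>I. G t i * u i) = (if t = s then 1 else 0)" if s: "s \<in> T" for s
  proof -
    have "card (T - {s}) < card T" using s finT by (rule card_Diff1_less[rotated])
    then have "\<not> P (T - {s})" using least by (metis linorder_not_less)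
    then obtain u where u: "\<forall>l\<in>T - {s}. (\<Sum>i\<in>I. G l i * u i) = 0" "\<not> (\<forall>i\<in>I. u i = 0)"
      using TL unfolding P_def by blast
    define g where "g = (\<Sum>i\<in>I. G s i * u i)"
    have "g \<noteq> 0" using u injT[of u] unfolding g_def by blast
    have "(\<Sum>i\<in>I. G t i * (u i / g)) = (if t = s then 1 else 0)" if "t \<in> T" for t
    proof -
      have "(\<Sum>i\<in>I. G t i * (u i / g)) = (\<Sum>i\<in>I. G t i * u i) / g"
        by (simp add: sum_divide_distrib)
      then show ?thesis using u(1) that \<open>g \<noteq> 0\<close> by (auto simp: g_def)
    qed
    then show ?thesis by (intro exI[of _ "\<lambda>i. u i / g"]) blast
  qed
  then obtain b where b: "\<And>s t. s \<in> T \<Longrightarrow> t \<in> T \<Longrightarrow> (\<Sum>i\<in>I. G t i * b s i) = (if t = s then 1 else 0)"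
    by metis
  have dec: "v i = (\<Sum>t\<in>T. (\<Sum>j\<in>I. G t j * v j) * b t i)" if "i \<in> I" for v i
  proof -
    let ?c = "\<lambda>t. \<Sum>j\<in>I. G t j * v j"
    have "(\<Sum>i\<in>I. G l i * (v i - (\<Sum>t\<in>T. ?c t * b t i))) = 0" if l: "l \<in> T" for l
    proof -
      have "(\<Sum>i\<in>I. G l i * (\<Sum>t\<in>T. ?c t * b t i)) = (\<Sum>i\<in>I. \<Sum>t\<in>T. ?c t * (G l i * b t i))"
        by (simp add: sum_distrib_left mult_ac)
      also have "\<dots> = (\<Sum>t\<in>T. ?c t * (\<Sum>i\<in>I. G l i * b t i))"
        by (subst sum.swap) (simp add: sum_distrib_left)
      also have "\<dots> = (\<Sum>t\<in>T. if l = t then ?c t else 0)"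
        using b l by (intro sum.cong) auto
      also have "\<dots> = ?c l" using l finT by (simp add: sum.delta')
      finally show ?thesis by (simp add: right_diff_distrib sum_subtractf)
    qed
    then show ?thesis using injT[of "\<lambda>i. v i - (\<Sum>t\<in>T. ?c t * b t i)"] that by auto
  qed
  show ?thesis
    by (intro exI[of _ T] exI[of _ b] conjI TL card ballI allI) (erule (1) b, erule dec)
qed

text \<open>
  A function of the subsets of \<open>T\<close>, identified with the points of the cube \<open>{0, 1}\<close> to the power \<open>T\<close>,
  that is a multilinear polynomial of degree at most \<open>d\<close>; \<open>c U\<close> is the coefficient of the monomial \<open>U\<close>.
\<close>

definition cube_poly :: "'t set \<Rightarrow> nat \<Rightarrow> ('t set \<Rightarrow> 'a::comm_ring_1) \<Rightarrow> bool"
  where "cube_poly T d g \<longleftrightarrow>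
    (\<exists>c. (\<forall>U. d < card U \<longrightarrow> c U = 0) \<and> (\<forall>S\<subseteq>T. g S = (\<Sum>U\<in>Pow S. c U)))"

lemma cube_poly_const: "finite T \<Longrightarrow> cube_poly T d (\<lambda>S. a)"
  unfolding cube_poly_def
proof (intro exI[of _ "\<lambda>U. if U = {} then a else 0"] conjI allI impI)
  fix S assume "finite T" "S \<subseteq> T"
  then have "finite (Pow S)" using finite_subset by auto
  then show "a = (\<Sum>U\<in>Pow S. if U = {} then a else 0)" by (simp add: sum.delta)
qed auto

lemma cube_poly_sum_point:
  assumes "finite T"
  shows "cube_poly T 1 (\<lambda>S. \<Sum>t\<in>S. k t)"
  unfolding cube_poly_def
proof (intro exI[of _ "\<lambda>U. if card U = 1 then k (the_elem U) else 0"] conjI allI impI)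
  fix S assume "S \<subseteq> T"
  then have fin: "finite S" using assms finite_subset by blast
  have "(\<Sum>U\<in>Pow S. if card U = 1 then k (the_elem U) else 0)
      = (\<Sum>U\<in>(\<lambda>t. {t}) ` S. if card U = 1 then k (the_elem U) else 0)"
    by (rule sum.mono_neutral_right) (use fin in \<open>auto simp: card_1_singleton_iff\<close>)
  also have "\<dots> = (\<Sum>t\<in>S. k t)"
    by (subst sum.reindex) (auto simp: inj_on_def)
  finally show "(\<Sum>t\<in>S. k t) = (\<Sum>U\<in>Pow S. if card U = 1 then k (the_elem U) else 0)" ..
qed auto

lemma cube_poly_add:
  assumes "cube_poly T d f" "cube_poly T d g"
  shows "cube_poly T d (\<lambda>S. f S + g S)"
proof -
  obtain a b where "\<forall>U. d < card U \<longrightarrow> a U = 0" "\<forall>S\<subseteq>T. f S = sum a (Pow S)"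
    "\<forall>U. d < card U \<longrightarrow> b U = 0" "\<forall>S\<subseteq>T. g S = sum b (Pow S)"
    using assms unfolding cube_poly_def by blast
  then show ?thesis unfolding cube_poly_def
    by (intro exI[of _ "\<lambda>U. a U + b U"]) (simp add: sum.distrib)
qed

text \<open>On the cube every variable equals its square, so the monomials \<open>U\<close> and
  \<open>V\<close> multiply to \<open>U \<union> V\<close>, whose degree is at most the sum of
  theirs. The coefficient \<open>c W\<close> collects the pairs with union \<open>W\<close>.\<close>

lemma cube_poly_mult:
  assumes T: "finite T" and "cube_poly T d f" "cube_poly T d' g"
  shows "cube_poly T (d + d') (\<lambda>S. f S * g S)"
proof -
  obtain a b where a: "\<And>U. d < card U \<Longrightarrow> a U = 0" "\<And>S. S\<subseteq>T \<Longrightarrow> f S = sum a (Pow S)"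
    and b: "\<And>U. d' < card U \<Longrightarrow> b U = 0" "\<And>S. S\<subseteq>T \<Longrightarrow> g S = sum b (Pow S)"
    using assms(2,3) unfolding cube_poly_def by metis
  define c where "c W = (\<Sum>(U, V)\<in>{x \<in> Pow W \<times> Pow W. fst x \<union> snd x = W}. a U * b V)" for W
  have "c W = 0" if W: "d + d' < card W" for W
    unfolding c_def
  proof (rule sum.neutral, rule ballI)
    fix x assume x: "x \<in> {x \<in> Pow W \<times> Pow W. fst x \<union> snd x = W}"
    obtain U V where UV: "x = (U, V)" by (cases x)
    have "card W \<le> card U + card V" using x UV card_Un_le[of U V] by auto
    then have "d < card U \<or> d' < card V" using W by linarith
    then have "a U * b V = 0" using a(1) b(1) by auto
    then show "(case x of (U, V) \<Rightarrow> a U * b V) = 0" using UV by simp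
  qed
  moreover have "f S * g S = sum c (Pow S)" if S: "S \<subseteq> T" for S
  proof -
    have fin: "finite S" using S T finite_subset by blast
    have "f S * g S = (\<Sum>(U, V)\<in>Pow S \<times> Pow S. a U * b V)"
      using a(2)[OF S] b(2)[OF S] by (simp add: sum_product sum.cartesian_product)
    also have "\<dots> = (\<Sum>W\<in>Pow S. \<Sum>(U, V)\<in>{x \<in> Pow S \<times> Pow S. fst x \<union> snd x = W}. a U * b V)"
      by (rule sum.group[symmetric]) (use fin in auto)
    also have "\<dots> = sum c (Pow S)"
      unfolding c_def by (intro sum.cong refl) auto
    finally show ?thesis .
  qed
  ultimately show ?thesis unfolding cube_poly_def by blast
qed

lemma cube_poly_sum:
  assumes "finite T" "finite A" "\<And>i. i \<in> A \<Longrightarrow> cube_poly T d (f i)"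
  shows "cube_poly T d (\<lambda>S. \<Sum>i\<in>A. f i S)"
  using assms(2,3) by induction (simp_all add: cube_poly_const cube_poly_add assms(1))

lemma cube_poly_prod:
  assumes "finite T" "finite A" "\<And>i. i \<in> A \<Longrightarrow> cube_poly T d (f i)"
  shows "cube_poly T (card A * d) (\<lambda>S. \<Prod>i\<in>A. f i S)"
  using assms(2,3) by induction (simp_all add: cube_poly_const cube_poly_mult assms(1))

text \<open>A monomial \<open>U\<close> of least degree with nonzero coefficient is itself such a
  point: at \<open>U\<close> only subsets of \<open>U\<close> contribute, and the proper ones have
  coefficient zero.\<close>

lemma cube_poly_nonzero_small:
  assumes "finite T" "cube_poly T d g" "g T \<noteq> 0"
  shows "\<exists>S\<subseteq>T. card S \<le> d \<and> g S \<noteq> 0"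
proof -
  obtain c where c: "\<And>U. d < card U \<Longrightarrow> c U = 0" "\<And>S. S\<subseteq>T \<Longrightarrow> g S = sum c (Pow S)"
    using assms(2) unfolding cube_poly_def by metis
  have "\<exists>U. U \<subseteq> T \<and> c U \<noteq> 0"
    using assms(3) c(2)[of T] by (metis PowD order_refl sum.neutral)
  then obtain U where U: "U \<subseteq> T" "c U \<noteq> 0"
    and least: "\<And>V. V \<subseteq> T \<Longrightarrow> c V \<noteq> 0 \<Longrightarrow> card U \<le> card V"
    using ex_has_least_nat[of "\<lambda>U. U \<subseteq> T \<and> c U \<noteq> 0" _ card] by metis
  have finU: "finite U" using U assms(1) finite_subset by blast
  have "c V = 0" if "V \<in> Pow U - {U}" for V
  proof -
    have "V \<subset> U" using that by auto
    then have "card V < card U" using finU by (rule psubset_card_mono[rotated])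
    then show ?thesis using least[of V] U \<open>V \<subset> U\<close> by fastforce
  qed
  then have "sum c (Pow U) = c U"
    using finU by (subst sum.remove[of _ U]) auto
  then show ?thesis using U c by (metis linorder_not_less)
qed

text \<open>
  The polynomial is the determinant of the matrix composed with a fixed left inverse of its value at \<open>T\<close>.
\<close>

lemma injectivity_cube_poly:
  fixes k :: "'t \<Rightarrow> 'e \<Rightarrow> 'i \<Rightarrow> 'a::field"
  assumes F: "finite (UNIV :: 'a set)" and E: "finite E" and I: "finite I" and T: "finite T"
    and inj: "\<forall>u. (\<forall>e\<in>E. (\<Sum>i\<in>I. (\<Sum>t\<in>T. k t e i) * u i) = 0) \<longrightarrow> (\<forall>i\<in>I. u i = 0)"
  shows "\<exists>g :: 't set \<Rightarrow> 'a. cube_poly T (card I) g \<and> g T \<noteq> 0 \<and>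
    (\<forall>S. g S \<noteq> 0 \<longrightarrow>
      (\<forall>u. (\<forall>e\<in>E. (\<Sum>i\<in>I. (\<Sum>t\<in>S. k t e i) * u i) = 0) \<longrightarrow> (\<forall>i\<in>I. u i = 0)))"
proof -
  define K where "K S e i = (\<Sum>t\<in>S. k t e i)" for S e i
  have injK: "\<forall>u. (\<forall>e\<in>E. (\<Sum>i\<in>I. K T e i * u i) = 0) \<longrightarrow> (\<forall>i\<in>I. u i = 0)"
    using inj unfolding K_def .
  \<comment> \<open>The vectors \<open>b e\<close> with \<open>e\<close> in \<open>R\<close> form a
    left inverse of the matrix at \<open>T\<close>.\<close>
  obtain R b where R: "R \<subseteq> E"
    and b: "\<forall>v. \<forall>i\<in>I. v i = (\<Sum>e\<in>R. (\<Sum>j\<in>I. K T e j * v j) * b e i)"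
    using information_set[OF F E I injK] by (elim exE conjE) (rule that)
  have finR: "finite R" using R E finite_subset by blast
  define n where "n = card I"
  obtain h where h: "bij_betw h {0..<n} I"
    using ex_bij_betw_nat_finite[OF I] unfolding n_def by blast
  have hI: "h r \<in> I" if "r < n" for r using h that by (auto simp: bij_betw_def)
  define W where "W S = mat n n (\<lambda>(r, s). \<Sum>e\<in>R. b e (h r) * K S e (h s))" for S
  have W: "W S \<in> carrier_mat n n" for S unfolding W_def by simp
  define g where "g S = det (W S)" for S
  have "cube_poly T (card I) g"
  proof -
    have entry: "cube_poly T 1 (\<lambda>S. W S $$ (r, s))" if "r < n" "s < n" for r s
    proof -
      have "cube_poly T 1 (\<lambda>S. \<Sum>e\<in>R. b e (h r) * K S e (h s))"
        unfolding K_def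
        using cube_poly_mult[OF T cube_poly_const[OF T, of 0] cube_poly_sum_point[OF T]]
        by (intro cube_poly_sum T finR) simp
      then show ?thesis using that by (simp add: W_def)
    qed
    \<comment> \<open>Leibniz formula: each term is a signed product of \<open>n\<close> entries of
      degree at most one.\<close>
    have "cube_poly T n (\<lambda>S. \<Sum>p\<in>{p. p permutes {0..<n}}. signof p * (\<Prod>i=0..<n. W S $$ (i, p i)))"
    proof (intro cube_poly_sum T finite_permutations)
      fix p assume p: "p \<in> {p. p permutes {0..<n}}"
      have "cube_poly T (card {0..<n} * 1) (\<lambda>S. \<Prod>i=0..<n. W S $$ (i, p i))"
        using p by (intro cube_poly_prod T entry) (auto dest: permutes_in_image)
      from cube_poly_mult[OF T cube_poly_const[OF T, of 0] this]
      show "cube_poly T n (\<lambda>S. signof p * (\<Prod>i=0..<n. W S $$ (i, p i)))" by simp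
    qed simp
    then show ?thesis unfolding g_def det_def n_def[symmetric] by (simp add: W_def)
  qed
  moreover have "g T \<noteq> 0"
  proof -
    have "W T = 1\<^sub>m n"
    proof (rule eq_matI)
      fix r s assume rs: "r < dim_row (1\<^sub>m n)" "s < dim_col (1\<^sub>m n)"
      then have "r < n" "s < n" by auto
      \<comment> \<open>The expansion formula for the unit vector at \<open>h s\<close>, read at the
        coordinate \<open>h r\<close>.\<close>
      have "(if h r = h s then 1 else 0) =
          (\<Sum>e\<in>R. (\<Sum>j\<in>I. K T e j * (if j = h s then 1 else 0)) * b e (h r))"
        using bspec[OF spec[OF b, of "\<lambda>i. if i = h s then 1 else 0"] hI[OF \<open>r < n\<close>]] by simp
      also have "\<dots> = (\<Sum>e\<in>R. b e (h r) * K T e (h s))"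
      proof (intro sum.cong refl)
        fix e
        have "(\<Sum>j\<in>I. K T e j * (if j = h s then 1 else 0)) = (\<Sum>j\<in>I. if j = h s then K T e j else 0)"
          by (intro sum.cong) auto
        then show "(\<Sum>j\<in>I. K T e j * (if j = h s then 1 else 0)) * b e (h r) = b e (h r) * K T e (h s)"
          using hI[OF \<open>s < n\<close>] I by (simp add: sum.delta)
      qed
      finally show "W T $$ (r, s) = 1\<^sub>m n $$ (r, s)"
        using h \<open>r < n\<close> \<open>s < n\<close> by (auto simp: W_def bij_betw_def inj_on_def split: if_splits)
    qed (auto simp: W_def)
    then show ?thesis by (simp add: g_def)
  qed
  moreover have "\<forall>i\<in>I. u i = 0"
    if "g S \<noteq> 0" and u: "\<forall>e\<in>E. (\<Sum>i\<in>I. (\<Sum>t\<in>S. k t e i) * u i) = 0" for S u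
  proof -
    define v where "v = vec n (\<lambda>s. u (h s))"
    have "W S *\<^sub>v v = 0\<^sub>v n"
    proof (rule eq_vecI)
      fix r assume "r < dim_vec (0\<^sub>v n)"
      then have r: "r < n" by simp
      have "(W S *\<^sub>v v) $ r = (\<Sum>s=0..<n. \<Sum>e\<in>R. b e (h r) * K S e (h s) * u (h s))"
        using r by (simp add: W_def v_def scalar_prod_def sum_distrib_right)
      also have "\<dots> = (\<Sum>i\<in>I. \<Sum>e\<in>R. b e (h r) * K S e i * u i)"
        by (rule sum.reindex_bij_betw[OF h])
      also have "\<dots> = (\<Sum>e\<in>R. b e (h r) * (\<Sum>i\<in>I. K S e i * u i))"
        by (subst sum.swap) (simp add: sum_distrib_left mult_ac)
      also have "\<dots> = 0"
        using u R unfolding K_def by (intro sum.neutral) auto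
      finally show "(W S *\<^sub>v v) $ r = 0\<^sub>v n $ r" using r by simp
    qed (simp add: W_def)
    then have "v = 0\<^sub>v n"
      using det_0_iff_vec_prod_zero_field[OF W[of S]] \<open>g S \<noteq> 0\<close> unfolding g_def v_def
      by (metis vec_carrier)
    show ?thesis
    proof
      fix i assume "i \<in> I"
      then obtain s where "s < n" "i = h s" using h by (auto simp: bij_betw_def)
      then show "u i = 0" using arg_cong[OF \<open>v = 0\<^sub>v n\<close>, of "\<lambda>v. v $ s"] by (simp add: v_def)
    qed
  qed
  ultimately show ?thesis by blast
qed

section \<open>An explicit family of matrices\<close>

definition indep3 :: "'a::field poly \<Rightarrow> 'a poly \<Rightarrow> 'a poly \<Rightarrow> bool"
  where "indep3 a b c \<longleftrightarrow>
    (\<forall>x y z. smult x a + smult y b + smult z c = 0 \<longrightarrow> x = 0 \<and> y = 0 \<and> z = 0)"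

lemma indep3_rotate: "indep3 a b c \<Longrightarrow> indep3 b c a"
  unfolding indep3_def by (metis add.commute add.left_commute)

lemma indep3_nonzero: "indep3 a b c \<Longrightarrow> a \<noteq> 0"
  unfolding indep3_def by (metis add_0 smult_0_left smult_0_right one_neq_zero)

lemma indep3_diff_smult: assumes "indep3 a b c" shows "indep3 (a - smult s b) b c"
  unfolding indep3_def
proof (intro allI impI)
  fix x y z assume "smult x (a - smult s b) + smult y b + smult z c = 0"
  then have "smult x a + smult (y - x * s) b + smult z c = 0"
    by (simp add: algebra_simps smult_diff_right smult_diff_left)
  then have "x = 0 \<and> y - x * s = 0 \<and> z = 0" using assms unfolding indep3_def by blast
  then show "x = 0 \<and> y = 0 \<and> z = 0" by simp
qed

section \<open>Dilations of polynomials and a determinant that detects independence\<close>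

definition dilate :: "nat \<Rightarrow> 'a::comm_ring_1 poly \<Rightarrow> 'a poly"
  where "dilate r a = pcompose a (monom 1 r)"

lemma dilate_diff: "dilate r (a - b) = dilate r a - dilate r b"
  by (simp add: dilate_def pcompose_diff)

lemma dilate_smult: "dilate r (smult c a) = smult c (dilate r a)"
  by (simp add: dilate_def pcompose_smult)

lemma degree_dilate: "degree (dilate r a) = r * degree (a :: 'a::idom poly)"
  by (simp add: dilate_def degree_pcompose degree_monom_eq mult.commute)

lemma dilate_eq_0_iff: "0 < r \<Longrightarrow> dilate r a = 0 \<longleftrightarrow> a = (0 :: 'a::idom poly)"
  unfolding dilate_def by (rule pcompose_eq_0_iff) (simp add: degree_monom_eq)

definition det3 :: "'a::idom \<Rightarrow> 'a \<Rightarrow> 'a \<Rightarrow> 'a \<Rightarrow> 'a \<Rightarrow> 'a \<Rightarrow> 'a \<Rightarrow> 'a \<Rightarrow> 'a \<Rightarrow> 'a"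
  where "det3 a0 a1 a2 b0 b1 b2 c0 c1 c2 =
    a0 * (b1 * c2 - b2 * c1) + a1 * (b2 * c0 - b0 * c2) + a2 * (b0 * c1 - b1 * c0)"

text \<open>An analogue of the Wronskian, with the substitutions of t^2 and t^3 for t in place of
  derivatives.\<close>

definition dilate_det :: "'a::idom poly \<Rightarrow> 'a poly \<Rightarrow> 'a poly \<Rightarrow> 'a poly"
  where "dilate_det a b c =
    det3 a b c (dilate 2 a) (dilate 2 b) (dilate 2 c) (dilate 3 a) (dilate 3 b) (dilate 3 c)"

lemma dilate_det_rotate: "dilate_det b c a = dilate_det a b c"
  by (simp add: dilate_det_def det3_def algebra_simps)

lemma dilate_det_swap: "dilate_det b a c = - dilate_det a b c"
  by (simp add: dilate_det_def det3_def algebra_simps)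

text \<open>Substitutions fix constants, so this is a column operation on the determinant.\<close>

lemma dilate_det_diff_smult: "dilate_det (a - smult s b) b c = dilate_det a b c"
  by (simp add: dilate_det_def det3_def dilate_diff dilate_smult algebra_simps)

text \<open>The rearrangement inequality singles out one of the six products as having the largest degree.\<close>

lemma dilate_det_nonzero_distinct_degrees:
  fixes a b c :: "'a::idom poly"
  assumes "a \<noteq> 0" "b \<noteq> 0" "c \<noteq> 0" "degree a < degree b" "degree b < degree c"
  shows "dilate_det a b c \<noteq> 0"
proof -
  define D where "D = degree a + 2 * degree b + 3 * degree c"
  define P where "P x y z = x * (dilate 2 y * dilate 3 z)" for x y z :: "'a poly"
  have nz: "x \<noteq> 0 \<Longrightarrow> y \<noteq> 0 \<Longrightarrow> z \<noteq> 0 \<Longrightarrow> P x y z \<noteq> 0" for x y z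
    by (simp add: P_def dilate_eq_0_iff)
  have deg: "degree (P x y z) = degree x + 2 * degree y + 3 * degree z"
    if "x \<noteq> 0" "y \<noteq> 0" "z \<noteq> 0" for x y z
    using that by (simp add: P_def degree_mult_eq dilate_eq_0_iff degree_dilate)
  have "dilate_det a b c = P a b c - P a c b + P b c a - P b a c + P c a b - P c b a"
    by (simp add: dilate_det_def det3_def P_def algebra_simps)
  moreover have "coeff (P a c b) D = 0" "coeff (P b c a) D = 0" "coeff (P b a c) D = 0"
    "coeff (P c a b) D = 0" "coeff (P c b a) D = 0"
    using assms by (auto intro!: coeff_eq_0 simp: deg D_def)
  ultimately have "coeff (dilate_det a b c) D = coeff (P a b c) D" by simp
  also have "\<dots> \<noteq> 0"
    using nz[of a b c] deg[of a b c] assms by (metis D_def leading_coeff_0_iff)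
  finally show ?thesis by auto
qed

text \<open>Induction on the total degree. If two degrees agree, a column operation cancels a
  leading term and preserves both the determinant and independence; otherwise a permutation makes
  the degrees strictly increasing.\<close>

lemma dilate_det_nonzero:
  fixes a b c :: "'a::field poly"
  assumes "indep3 a b c"
  shows "dilate_det a b c \<noteq> 0"
  using assms
proof (induction "degree a + degree b + degree c" arbitrary: a b c rule: less_induct)
  case less
  note nz = indep3_nonzero[OF less.prems] indep3_nonzero[OF indep3_rotate[OF less.prems]]
    indep3_nonzero[OF indep3_rotate[OF indep3_rotate[OF less.prems]]]
  have reduce: "dilate_det x y z \<noteq> 0"
    if xyz: "indep3 x y z" and eq: "degree x = degree y"
      and sum: "degree x + degree y + degree z = degree a + degree b + degree c" for x y z :: "'a poly"
  proof -
    define s where "s = lead_coeff x / lead_coeff y"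
    let ?x = "x - smult s y"
    have "y \<noteq> 0" using indep3_nonzero[OF indep3_rotate[OF xyz]] .
    have ind: "indep3 ?x y z" using xyz by (rule indep3_diff_smult)
    have "coeff ?x (degree x) = 0" using \<open>y \<noteq> 0\<close> eq by (simp add: s_def)
    \<comment> \<open>Independence keeps \<open>?x\<close> nonzero, so losing the coefficient at the
      old degree lowers the degree.\<close>
    then have "degree ?x \<noteq> degree x" using indep3_nonzero[OF ind] by (metis leading_coeff_0_iff)
    moreover have "degree ?x \<le> degree x" using eq by (intro degree_diff_le) (auto simp: degree_smult_le)
    ultimately have "degree ?x + degree y + degree z < degree a + degree b + degree c"
      using sum by linarith
    from less.hyps[OF this ind] show ?thesis by (simp add: dilate_det_diff_smult)
  qed
  consider "degree a = degree b" | "degree b = degree c" | "degree c = degree a"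
    | "degree a < degree b" "degree b < degree c" | "degree a < degree c" "degree c < degree b"
    | "degree b < degree a" "degree a < degree c" | "degree b < degree c" "degree c < degree a"
    | "degree c < degree a" "degree a < degree b" | "degree c < degree b" "degree b < degree a"
    by linarith
  then show ?case
  proof cases
    case 1
    then show ?thesis using reduce less.prems by blast
  next
    case 2
    then show ?thesis using reduce[of b c a] indep3_rotate[OF less.prems] by (simp add: dilate_det_rotate)
  next
    case 3
    then show ?thesis using reduce[of c a b] indep3_rotate[OF indep3_rotate[OF less.prems]]
      by (simp add: dilate_det_rotate)
  qed (use nz dilate_det_nonzero_distinct_degrees dilate_det_rotate[of a b c] dilate_det_rotate[of b c a]
      dilate_det_swap[of a b c] dilate_det_swap[of b c a] dilate_det_swap[of c a b] in \<open>metis neg_equal_0_iff_equal\<close>)+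
qed

text \<open>The hypotheses are the coordinates of a wedge x + b wedge y = 0. Wedging with a leaves
  only a wedge b wedge y, and wedging with b leaves only a wedge b wedge x.\<close>

lemma det3_wedge_eq_0:
  fixes a0 :: "'a::idom"
  assumes "a0 * x1 + b0 * y1 = a1 * x0 + b1 * y0" "a1 * x2 + b1 * y2 = a2 * x1 + b2 * y1"
    "a2 * x0 + b2 * y0 = a0 * x2 + b0 * y2"
  shows "det3 a0 a1 a2 b0 b1 b2 y0 y1 y2 = 0" and "det3 a0 a1 a2 b0 b1 b2 x0 x1 x2 = 0"
proof -
  have e: "(a0 * x1 + b0 * y1) - (a1 * x0 + b1 * y0) = 0" "(a1 * x2 + b1 * y2) - (a2 * x1 + b2 * y1) = 0"
    "(a2 * x0 + b2 * y0) - (a0 * x2 + b0 * y2) = 0"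
    using assms by simp_all
  have "det3 a0 a1 a2 b0 b1 b2 y0 y1 y2 = a0 * ((a1 * x2 + b1 * y2) - (a2 * x1 + b2 * y1))
      + a1 * ((a2 * x0 + b2 * y0) - (a0 * x2 + b0 * y2)) + a2 * ((a0 * x1 + b0 * y1) - (a1 * x0 + b1 * y0))"
    by (simp add: det3_def algebra_simps)
  then show "det3 a0 a1 a2 b0 b1 b2 y0 y1 y2 = 0" unfolding e by simp
  have "det3 a0 a1 a2 b0 b1 b2 x0 x1 x2 = - (b0 * ((a1 * x2 + b1 * y2) - (a2 * x1 + b2 * y1))
      + b1 * ((a2 * x0 + b2 * y0) - (a0 * x2 + b0 * y2)) + b2 * ((a0 * x1 + b0 * y1) - (a1 * x0 + b1 * y0)))"
    by (simp add: det3_def algebra_simps)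
  then show "det3 a0 a1 a2 b0 b1 b2 x0 x1 x2 = 0" unfolding e by simp
qed

text \<open>Multiplied by \<open>D\<close>, the term a wedge x of \<open>e\<close> becomes r (a
  wedge a) = 0 and b wedge y becomes s (b wedge a). Keeping \<open>D\<close> on the left avoids
  division in the domain.\<close>

lemma wedge_parallel_eq_0:
  fixes a0 :: "'a::idom"
  assumes "D * x0 = r * a0" "D * x1 = r * a1" "D * y0 = s * a0" "D * y1 = s * a1"
    and e: "a0 * x1 + b0 * y1 = a1 * x0 + b1 * y0"
  shows "s * (b0 * a1 - b1 * a0) = 0"
proof -
  have "s * (b0 * a1 - b1 * a0) = a0 * (r * a1) + b0 * (s * a1) - (a1 * (r * a0) + b1 * (s * a0))"
    by (simp add: algebra_simps)
  also have "\<dots> = a0 * (D * x1) + b0 * (D * y1) - (a1 * (D * x0) + b1 * (D * y0))"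
    by (simp only: assms(1-4))
  also have "\<dots> = D * ((a0 * x1 + b0 * y1) - (a1 * x0 + b1 * y0))"
    by (simp add: algebra_simps)
  finally show ?thesis using e by simp
qed

text \<open>
  With \<open>a\<close>, \<open>b\<close>, \<open>c\<close>, \<open>x\<close>, \<open>y\<close> read as vectors of length three, the hypotheses say
  \<open>a \<and> x + b \<and> y = 0\<close> and \<open>c \<and> x + a \<and> y = 0\<close>. Wedging with \<open>a\<close>, \<open>b\<close>, \<open>c\<close> shows that \<open>x\<close> and \<open>y\<close> are
  multiples of \<open>a\<close>.
\<close>

lemma koszul_2x2_kernel:
  fixes a0 :: "'a::idom"
  assumes nz: "det3 a0 a1 a2 b0 b1 b2 c0 c1 c2 \<noteq> 0"
    and E: "a0 * x1 + b0 * y1 = a1 * x0 + b1 * y0" "a1 * x2 + b1 * y2 = a2 * x1 + b2 * y1"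
      "a2 * x0 + b2 * y0 = a0 * x2 + b0 * y2"
    and F: "c0 * x1 + a0 * y1 = c1 * x0 + a1 * y0" "c1 * x2 + a1 * y2 = c2 * x1 + a2 * y1"
      "c2 * x0 + a2 * y0 = c0 * x2 + a0 * y2"
  shows "x0 = 0 \<and> x1 = 0 \<and> x2 = 0 \<and> y0 = 0 \<and> y1 = 0 \<and> y2 = 0"
proof -
  let ?D = "det3 a0 a1 a2 b0 b1 b2 c0 c1 c2"
  \<comment> \<open>Cramer's identity: D z is a combination of a, b, c whose coefficients are the
    determinants with z in place of one of them.\<close>
  have expand: "?D * z0 = det3 z0 z1 z2 b0 b1 b2 c0 c1 c2 * a0 + det3 c0 c1 c2 a0 a1 a2 z0 z1 z2 * b0
        + det3 a0 a1 a2 b0 b1 b2 z0 z1 z2 * c0"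
      "?D * z1 = det3 z0 z1 z2 b0 b1 b2 c0 c1 c2 * a1 + det3 c0 c1 c2 a0 a1 a2 z0 z1 z2 * b1
        + det3 a0 a1 a2 b0 b1 b2 z0 z1 z2 * c1"
      "?D * z2 = det3 z0 z1 z2 b0 b1 b2 c0 c1 c2 * a2 + det3 c0 c1 c2 a0 a1 a2 z0 z1 z2 * b2
        + det3 a0 a1 a2 b0 b1 b2 z0 z1 z2 * c2" for z0 z1 z2
    unfolding det3_def by (simp_all add: algebra_simps)
  have cramer: "?D * z0 = det3 z0 z1 z2 b0 b1 b2 c0 c1 c2 * a0"
      "?D * z1 = det3 z0 z1 z2 b0 b1 b2 c0 c1 c2 * a1" "?D * z2 = det3 z0 z1 z2 b0 b1 b2 c0 c1 c2 * a2"
    if "det3 a0 a1 a2 b0 b1 b2 z0 z1 z2 = 0" "det3 c0 c1 c2 a0 a1 a2 z0 z1 z2 = 0" for z0 z1 z2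
    using expand(1)[of z0 z1 z2] expand(2)[of z1 z0 z2] expand(3)[of z2 z0 z1] that by simp_all
  have "det3 a0 a1 a2 b0 b1 b2 y0 y1 y2 = 0" "det3 a0 a1 a2 b0 b1 b2 x0 x1 x2 = 0"
    using E by (rule det3_wedge_eq_0)+
  moreover have "det3 c0 c1 c2 a0 a1 a2 y0 y1 y2 = 0" "det3 c0 c1 c2 a0 a1 a2 x0 x1 x2 = 0"
    using F by (rule det3_wedge_eq_0)+
  ultimately have X: "?D * x0 = det3 x0 x1 x2 b0 b1 b2 c0 c1 c2 * a0"
      "?D * x1 = det3 x0 x1 x2 b0 b1 b2 c0 c1 c2 * a1" "?D * x2 = det3 x0 x1 x2 b0 b1 b2 c0 c1 c2 * a2"
    and Y: "?D * y0 = det3 y0 y1 y2 b0 b1 b2 c0 c1 c2 * a0"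
      "?D * y1 = det3 y0 y1 y2 b0 b1 b2 c0 c1 c2 * a1" "?D * y2 = det3 y0 y1 y2 b0 b1 b2 c0 c1 c2 * a2"
    using cramer by blast+
  define D where "D = ?D"
  define r where "r = det3 x0 x1 x2 b0 b1 b2 c0 c1 c2"
  define s where "s = det3 y0 y1 y2 b0 b1 b2 c0 c1 c2"
  have X': "D * x0 = r * a0" "D * x1 = r * a1" "D * x2 = r * a2"
    and Y': "D * y0 = s * a0" "D * y1 = s * a1" "D * y2 = s * a2"
    using X Y unfolding D_def r_def s_def by auto
  \<comment> \<open>The minors of a and b in this expansion along c are killed by \<open>E\<close>;
    those of a and c, in the expansion along b below, by \<open>F\<close>.\<close>
  have "s * D = - (c2 * (s * (b0 * a1 - b1 * a0)) + c0 * (s * (b1 * a2 - b2 * a1)) + c1 * (s * (b2 * a0 - b0 * a2)))"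
    unfolding D_def det3_def by (simp add: algebra_simps)
  also have "\<dots> = 0"
    unfolding wedge_parallel_eq_0[OF X'(1,2) Y'(1,2) E(1)] wedge_parallel_eq_0[OF X'(2,3) Y'(2,3) E(2)]
      wedge_parallel_eq_0[OF X'(3,1) Y'(3,1) E(3)] by simp
  finally have s: "s = 0" using nz D_def by simp
  \<comment> \<open>Swapping the summands exchanges x with y and puts c in the role of b.\<close>
  note F' = F[unfolded add.commute[of "_ * x0"] add.commute[of "_ * x1"] add.commute[of "_ * x2"]]
  have "r * D = b2 * (r * (c0 * a1 - c1 * a0)) + b0 * (r * (c1 * a2 - c2 * a1)) + b1 * (r * (c2 * a0 - c0 * a2))"
    unfolding D_def det3_def by (simp add: algebra_simps)
  also have "\<dots> = 0"
    unfolding wedge_parallel_eq_0[OF Y'(1,2) X'(1,2) F'(1)] wedge_parallel_eq_0[OF Y'(2,3) X'(2,3) F'(2)]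
      wedge_parallel_eq_0[OF Y'(3,1) X'(3,1) F'(3)] by simp
  finally have "r * D = 0" .
  then have "r = 0" using nz D_def by simp
  then show ?thesis using X' Y' s nz D_def by simp
qed

text \<open>
  Injectivity of the Koszul map \<open>u \<mapsto> (A i (u j) - A j (u i))\<close> of a triple of matrices \<open>A 0\<close>, \<open>A 1\<close>,
  \<open>A 2\<close>, restricted to their first \<open>q\<close> columns.
\<close>

definition koszul_inj :: "nat \<Rightarrow> nat \<Rightarrow> (nat \<Rightarrow> nat \<Rightarrow> nat \<Rightarrow> 'a::comm_ring_1) \<Rightarrow> bool"
  where "koszul_inj n q A \<longleftrightarrow>
    (\<forall>u. (\<forall>i<3. \<forall>j<3. \<forall>r<n. (\<Sum>d<q. A i r d * u j d) = (\<Sum>d<q. A j r d * u i d)) \<longrightarrow>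
      (\<forall>j<3. \<forall>d<q. u j d = 0))"

lemma koszul_inj_cong:
  fixes A B :: "nat \<Rightarrow> nat \<Rightarrow> nat \<Rightarrow> 'a::comm_ring_1"
  assumes "\<And>i r d. i < 3 \<Longrightarrow> r < n \<Longrightarrow> d < q \<Longrightarrow> A i r d = B i r d" and "koszul_inj n q A"
  shows "koszul_inj n q B"
proof -
  have eq: "(\<Sum>d<q. A i r d * u d) = (\<Sum>d<q. B i r d * u d)" if "i < 3" "r < n" for i r u
    using assms(1) that by (intro sum.cong) auto
  show ?thesis unfolding koszul_inj_def
  proof (intro allI impI)
    fix u :: "nat \<Rightarrow> nat \<Rightarrow> 'a" and j d :: nat
    assume "\<forall>i<3. \<forall>j<3. \<forall>r<n. (\<Sum>d<q. B i r d * u j d) = (\<Sum>d<q. B j r d * u i d)"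
    then have "\<forall>i<3. \<forall>j<3. \<forall>r<n. (\<Sum>d<q. A i r d * u j d) = (\<Sum>d<q. A j r d * u i d)"
      by (simp add: eq)
    moreover assume "j < 3" "d < q"
    ultimately show "u j d = 0" using assms(2) unfolding koszul_inj_def by blast
  qed
qed

lemma sum_lessThan_add: "(\<Sum>d<m + k. f d) = (\<Sum>d<m. f d) + (\<Sum>d<k. f (m + d))"
  for f :: "nat \<Rightarrow> 'a::comm_monoid_add"
  by (induction k) (simp_all add: add.assoc)

text \<open>
  Multiplication by the block matrix \<open>[[a(t), a(t\<^sup>2)], [a(t\<^sup>3), a(t)]]\<close> on pairs of polynomials of degree
  less than \<open>e\<close>. The first component of the result occupies the rows below \<open>N\<close>, the second one the
  rows from \<open>N\<close> on.
\<close>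

definition dilate_mat :: "nat \<Rightarrow> nat \<Rightarrow> 'a::comm_ring_1 poly \<Rightarrow> nat \<Rightarrow> nat \<Rightarrow> 'a"
  where "dilate_mat e N a r d = coeff (if d < e then (a + monom 1 N * dilate 3 a) * monom 1 d
    else (dilate 2 a + monom 1 N * a) * monom 1 (d - e)) r"

lemma dilate_mat_diff:
  "dilate_mat e N (a - b) = (\<lambda>r d. dilate_mat e N a r d - dilate_mat e N b r d)"
  by (simp add: dilate_mat_def dilate_diff algebra_simps fun_eq_iff)

text \<open>The vector \<open>u\<close> encodes two polynomials by its first and its last
  \<open>e\<close> coordinates; this turns matrix equations into polynomial identities.\<close>

lemma dilate_mat_apply:
  "(\<Sum>d<2 * e. dilate_mat e N a r d * u d) =
    coeff ((a + monom 1 N * dilate 3 a) * (\<Sum>d<e. monom (u d) d)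
      + (dilate 2 a + monom 1 N * a) * (\<Sum>d<e. monom (u (e + d)) d)) r"
proof -
  have *: "coeff (P * (\<Sum>d<e. monom (f d) d)) r = (\<Sum>d<e. coeff (P * monom 1 d) r * f d)"
    for P :: "'a poly" and f
  proof -
    have "P * (\<Sum>d<e. monom (f d) d) = (\<Sum>d<e. smult (f d) (P * monom 1 d))"
      by (simp add: sum_distrib_left smult_monom flip: mult_smult_right)
    then show ?thesis by (simp add: coeff_sum mult.commute)
  qed
  have "(\<Sum>d<2 * e. dilate_mat e N a r d * u d) =
      (\<Sum>d<e. dilate_mat e N a r d * u d) + (\<Sum>d<e. dilate_mat e N a r (e + d) * u (e + d))"
    using sum_lessThan_add[of _ e e] by (simp add: mult_2)
  then show ?thesis by (simp add: * dilate_mat_def)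
qed

text \<open>Uniqueness of quotient and remainder on division by t^N.\<close>

lemma split_at_monom:
  fixes f f' g g' :: "'a::comm_ring_1 poly"
  assumes eq: "f + monom 1 N * g = f' + monom 1 N * g'"
    and low: "\<And>r. N \<le> r \<Longrightarrow> coeff f r = 0" "\<And>r. N \<le> r \<Longrightarrow> coeff f' r = 0"
  shows "f = f' \<and> g = g'"
proof -
  have c: "coeff f r + (if r < N then 0 else coeff g (r - N)) =
      coeff f' r + (if r < N then 0 else coeff g' (r - N))" for r
    using arg_cong[OF eq, of "\<lambda>p. coeff p r"] by (simp add: coeff_monom_mult split: if_splits)
  have "f = f'"
  proof (rule poly_eqI)
    fix r show "coeff f r = coeff f' r" using c[of r] low[of r] by (cases "r < N") auto
  qed
  moreover have "g = g'"
  proof (rule poly_eqI)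
    fix r show "coeff g r = coeff g' r" using c[of "N + r"] low[of "N + r"] by simp
  qed
  ultimately show ?thesis ..
qed

lemma all_less_3: "(\<forall>i<3. P i) \<longleftrightarrow> P 0 \<and> P 1 \<and> P (2::nat)"
  by (auto simp: numeral_3_eq_3 less_Suc_eq numeral_2_eq_2)

text \<open>A dilated entry has degree at most 3 (k - 1) and an unknown at most e - 1, so components
  of height \<open>e + 3 * k\<close> do not overlap. The matrix equations thus become the wedge
  equations of \<open>koszul_2x2_kernel\<close> over polynomials, with \<open>dilate_det\<close> as
  the determinant.\<close>

lemma koszul_inj_dilate_mat:
  fixes a :: "nat \<Rightarrow> 'a::field poly"
  assumes ind: "indep3 (a 0) (a 1) (a 2)" and deg: "\<And>i. i < 3 \<Longrightarrow> degree (a i) < k"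
    and n: "2 * (e + 3 * k) \<le> n"
  shows "koszul_inj n (2 * e) (\<lambda>i. dilate_mat e (e + 3 * k) (a i))"
  unfolding koszul_inj_def
proof (intro allI impI)
  fix u :: "nat \<Rightarrow> nat \<Rightarrow> 'a" and j d :: nat
  let ?N = "e + 3 * k"
  assume u: "\<forall>i<3. \<forall>j<3. \<forall>r<n. (\<Sum>d<2 * e. dilate_mat e ?N (a i) r d * u j d) =
      (\<Sum>d<2 * e. dilate_mat e ?N (a j) r d * u i d)"
    and j: "j < 3" and d: "d < 2 * e"
  then have "0 < e" by simp
  have k: "0 < k" using deg[of 0] by simp
  define x where "x j = (\<Sum>d<e. monom (u j d) d)" for j
  define y where "y j = (\<Sum>d<e. monom (u j (e + d)) d)" for j
  define low where "low i j = a i * x j + dilate 2 (a i) * y j" for i j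
  define high where "high i j = dilate 3 (a i) * x j + a i * y j" for i j
  have coeff_x: "coeff (x j) d = (if d < e then u j d else 0)"
    and coeff_y: "coeff (y j) d = (if d < e then u j (e + d) else 0)" for j d
    by (simp_all add: x_def y_def coeff_sum)
  have deg_xy: "degree (x j) \<le> e - 1" "degree (y j) \<le> e - 1" for j
    by (rule degree_le; auto simp: coeff_x coeff_y)+
  have deg_mult: "degree (p * q) < ?N" if "degree p \<le> 3 * (k - 1)" "degree q \<le> e - 1"
    for p q :: "'a poly"
    using degree_mult_le[of p q] that \<open>0 < e\<close> k by linarith
  have deg_a: "degree (dilate r (a i)) \<le> 3 * (k - 1)" if "i < 3" "r \<le> 3" for i r
    using deg[OF that(1)] that(2) k by (simp add: degree_dilate mult_mono)
  have deg_a1: "degree (a i) \<le> 3 * (k - 1)" if "i < 3" for i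
    using deg[OF that] k by linarith
  have deg_low: "degree (low i j) < ?N" and deg_high: "degree (high i j) < ?N" if "i < 3" for i j
    unfolding low_def high_def
    by (intro degree_add_less deg_mult deg_a1 deg_a that deg_xy; simp)+
  have eq: "low i j = low j i \<and> high i j = high j i" if ij: "i < 3" "j < 3" for i j
  proof (rule split_at_monom)
    have expand: "(a i + monom 1 ?N * dilate 3 (a i)) * x j + (dilate 2 (a i) + monom 1 ?N * a i) * y j
        = low i j + monom 1 ?N * high i j" for i j
      by (simp add: low_def high_def algebra_simps)
    \<comment> \<open>There are no coefficients from row \<open>n\<close> on, so the equations for
      \<open>r < n\<close> already give equality of polynomials.\<close>
    have vanish: "coeff (low i j + monom 1 ?N * high i j) r = 0" if "n \<le> r" "i < 3" for i j r
    proof -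
      have "coeff (low i j) r = 0" "coeff (high i j) (r - ?N) = 0"
        using deg_low[OF that(2), of j] deg_high[OF that(2), of j] n that(1)
        by (auto intro!: coeff_eq_0)
      then show ?thesis by (simp add: coeff_monom_mult)
    qed
    show "low i j + monom 1 ?N * high i j = low j i + monom 1 ?N * high j i"
    proof (rule poly_eqI)
      fix r
      show "coeff (low i j + monom 1 ?N * high i j) r = coeff (low j i + monom 1 ?N * high j i) r"
      proof (cases "r < n")
        case True
        then have "(\<Sum>d<2 * e. dilate_mat e ?N (a i) r d * u j d) =
            (\<Sum>d<2 * e. dilate_mat e ?N (a j) r d * u i d)"
          using u ij by blast
        then show ?thesis unfolding dilate_mat_apply x_def[symmetric] y_def[symmetric] expand .
      next
        case False
        then show ?thesis using vanish ij by simp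
      qed
    qed
  qed (use deg_low ij in \<open>auto intro!: coeff_eq_0 intro: less_le_trans\<close>)
  have "x 0 = 0 \<and> x 1 = 0 \<and> x 2 = 0 \<and> y 0 = 0 \<and> y 1 = 0 \<and> y 2 = 0"
    by (rule koszul_2x2_kernel[OF dilate_det_nonzero[OF ind, unfolded dilate_det_def]])
      (use eq[of 0 1] eq[of 1 2] eq[of 2 0] in \<open>simp_all add: low_def high_def\<close>)
  then have "\<forall>j<3. x j = 0 \<and> y j = 0" by (simp add: all_less_3)
  then have "x j = 0" "y j = 0" using j by auto
  then show "u j d = 0"
    using coeff_x[of j d] coeff_y[of j "d - e"] d by (cases "d < e") (simp_all add: split: if_splits)
qed

text \<open>The Koszul map is linear in the triple and has \<open>3 * q\<close> unknowns, which is
  the degree supplied by \<open>injectivity_cube_poly\<close>.\<close>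

lemma koszul_inj_cube_poly:
  fixes A :: "'t \<Rightarrow> nat \<Rightarrow> nat \<Rightarrow> nat \<Rightarrow> 'a::field"
  assumes F: "finite (UNIV :: 'a set)" and T: "finite T"
    and inj: "koszul_inj n q (\<lambda>i r d. \<Sum>t\<in>T. A t i r d)"
  shows "\<exists>g :: 't set \<Rightarrow> 'a. cube_poly T (3 * q) g \<and> g T \<noteq> 0 \<and>
    (\<forall>S. g S \<noteq> 0 \<longrightarrow> koszul_inj n q (\<lambda>i r d. \<Sum>t\<in>S. A t i r d))"
proof -
  define E where "E = {..<3::nat} \<times> {..<3::nat} \<times> {..<n}"
  define I where "I = {..<3::nat} \<times> {..<q}"
  \<comment> \<open>The row \<open>(i, j, r)\<close> is an equation of the Koszul map, and the
    column \<open>(s, d)\<close> stands for the unknown \<open>u s d\<close>.\<close>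
  define K where "K t = (\<lambda>(i, j, r) (s, d). (if s = j then A t i r d else 0) - (if s = i then A t j r d else 0))"
    for t
  have sum_K: "(\<Sum>x\<in>I. (\<Sum>t\<in>S. K t (i, j, r) x) * u x) =
      (\<Sum>d<q. (\<Sum>t\<in>S. A t i r d) * u (j, d)) - (\<Sum>d<q. (\<Sum>t\<in>S. A t j r d) * u (i, d))"
    if ij: "i < 3" "j < 3" for S i j r u
  proof -
    have pick: "(\<Sum>s<3. \<Sum>d<q. if s = m then f s d else 0) = (\<Sum>d<q. f m d)" if "m < 3"
      for m :: nat and f :: "nat \<Rightarrow> nat \<Rightarrow> 'a"
      using that by (subst sum.swap) (simp add: sum.delta)
    have "(\<Sum>t\<in>S. K t (i, j, r) (s, d)) * u (s, d) =
        (if s = j then (\<Sum>t\<in>S. A t i r d) * u (s, d) else 0) -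
        (if s = i then (\<Sum>t\<in>S. A t j r d) * u (s, d) else 0)" for s d
      by (simp add: K_def sum_subtractf left_diff_distrib sum_distrib_right)
    then have "(\<Sum>x\<in>I. (\<Sum>t\<in>S. K t (i, j, r) x) * u x) =
        (\<Sum>s<3. \<Sum>d<q. (if s = j then (\<Sum>t\<in>S. A t i r d) * u (s, d) else 0) -
          (if s = i then (\<Sum>t\<in>S. A t j r d) * u (s, d) else 0))"
      unfolding I_def by (simp add: sum.cartesian_product')
    also have "\<dots> = (\<Sum>d<q. (\<Sum>t\<in>S. A t i r d) * u (j, d)) - (\<Sum>d<q. (\<Sum>t\<in>S. A t j r d) * u (i, d))"
      by (simp only: sum_subtractf pick[OF ij(1)] pick[OF ij(2)])
    finally show ?thesis .
  qed
  have equiv: "(\<forall>u. (\<forall>x\<in>E. (\<Sum>y\<in>I. (\<Sum>t\<in>S. K t x y) * u y) = 0) \<longrightarrow> (\<forall>y\<in>I. u y = 0))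
      \<longleftrightarrow> koszul_inj n q (\<lambda>i r d. \<Sum>t\<in>S. A t i r d)" for S
  proof -
    have 1: "(\<forall>x\<in>E. (\<Sum>y\<in>I. (\<Sum>t\<in>S. K t x y) * u y) = 0) \<longleftrightarrow>
        (\<forall>i<3. \<forall>j<3. \<forall>r<n. (\<Sum>d<q. (\<Sum>t\<in>S. A t i r d) * u (j, d)) = (\<Sum>d<q. (\<Sum>t\<in>S. A t j r d) * u (i, d)))" for u
      unfolding E_def using sum_K[where S = S and u = u] by auto
    have 2: "(\<forall>y\<in>I. u y = 0) \<longleftrightarrow> (\<forall>j<3. \<forall>d<q. u (j, d) = 0)" for u :: "nat \<times> nat \<Rightarrow> 'a"
      unfolding I_def by auto
    show ?thesis unfolding 1 2 koszul_inj_def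
    proof safe
      fix u :: "nat \<Rightarrow> nat \<Rightarrow> 'a" and j d :: nat
      assume H: "\<forall>u. (\<forall>i<3. \<forall>j<3. \<forall>r<n. (\<Sum>d<q. (\<Sum>t\<in>S. A t i r d) * u (j, d)) =
          (\<Sum>d<q. (\<Sum>t\<in>S. A t j r d) * u (i, d))) \<longrightarrow> (\<forall>j<3. \<forall>d<q. u (j, d) = 0)"
        and "\<forall>i<3. \<forall>j<3. \<forall>r<n. (\<Sum>d<q. (\<Sum>t\<in>S. A t i r d) * u j d) = (\<Sum>d<q. (\<Sum>t\<in>S. A t j r d) * u i d)"
        and "j < 3" "d < q"
      then show "u j d = 0" using spec[OF H, of "case_prod u"] by simp
    next
      fix u :: "nat \<times> nat \<Rightarrow> 'a" and j d :: nat
      assume H: "\<forall>u. (\<forall>i<3. \<forall>j<3. \<forall>r<n. (\<Sum>d<q. (\<Sum>t\<in>S. A t i r d) * u j d) =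
          (\<Sum>d<q. (\<Sum>t\<in>S. A t j r d) * u i d)) \<longrightarrow> (\<forall>j<3. \<forall>d<q. u j d = 0)"
        and "\<forall>i<3. \<forall>j<3. \<forall>r<n. (\<Sum>d<q. (\<Sum>t\<in>S. A t i r d) * u (j, d)) = (\<Sum>d<q. (\<Sum>t\<in>S. A t j r d) * u (i, d))"
        and "j < 3" "d < q"
      then show "u (j, d) = 0" using spec[OF H, of "curry u"] by (simp add: curry_def)
    qed
  qed
  have fin: "finite E" "finite I" and card: "card I = 3 * q" unfolding E_def I_def by auto
  show ?thesis
    using injectivity_cube_poly[OF F fin T, of K] inj unfolding equiv card by blast
qed

section \<open>Counting products\<close>

definition out_comb :: "nat \<Rightarrow> (nat \<Rightarrow> nat \<Rightarrow> 'l \<Rightarrow> 'a::comm_ring_1) \<Rightarrow> 'l \<Rightarrow> (nat \<Rightarrow> nat \<Rightarrow> 'a) \<Rightarrow> 'a"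
  where "out_comb n w l A = (\<Sum>i<n. \<Sum>j<n. w i j l * A i j)"

text \<open>
  The bilinear forms \<open>\<mu> l (x) \<eta> l (y)\<close> compute the matrix product, \<open>w i j l\<close> being the coefficient of
  product \<open>l\<close> in the output \<open>(i, j)\<close>.
\<close>

definition matmul_tensor ::
    "nat \<Rightarrow> 'l set \<Rightarrow> (nat \<Rightarrow> nat \<Rightarrow> 'l \<Rightarrow> 'a::comm_ring_1) \<Rightarrow>
      ('l \<Rightarrow> nat \<Rightarrow> nat \<Rightarrow> 'a) \<Rightarrow> ('l \<Rightarrow> nat \<Rightarrow> nat \<Rightarrow> 'a) \<Rightarrow> bool"
  where "matmul_tensor n L w \<mu> \<eta> \<longleftrightarrow> (\<forall>i<n. \<forall>j<n. \<forall>a<n. \<forall>b<n. \<forall>c<n. \<forall>d<n.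
    (\<Sum>l\<in>L. w i j l * (\<mu> l a b * \<eta> l c d)) = (if a = i \<and> d = j \<and> b = c then 1 else 0))"

text \<open>Summing the tensor identity against the entries of \<open>A\<close> recovers each of
  them from the code word of \<open>A\<close>.\<close>

lemma out_comb_contract:
  assumes "matmul_tensor n L w \<mu> \<eta>" and "a < n" "b < n" "c < n" "d < n"
  shows "(\<Sum>l\<in>L. out_comb n w l A * (\<mu> l a b * \<eta> l c d)) = (if b = c then A a d else 0)"
proof -
  have "(\<Sum>l\<in>L. out_comb n w l A * (\<mu> l a b * \<eta> l c d)) =
      (\<Sum>l\<in>L. \<Sum>i<n. \<Sum>j<n. A i j * (w i j l * (\<mu> l a b * \<eta> l c d)))"
    by (simp add: out_comb_def sum_distrib_left sum_distrib_right mult_ac)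
  also have "\<dots> = (\<Sum>i<n. \<Sum>l\<in>L. \<Sum>j<n. A i j * (w i j l * (\<mu> l a b * \<eta> l c d)))"
    by (rule sum.swap)
  also have "\<dots> = (\<Sum>i<n. \<Sum>j<n. \<Sum>l\<in>L. A i j * (w i j l * (\<mu> l a b * \<eta> l c d)))"
    by (intro sum.cong refl sum.swap)
  also have "\<dots> = (\<Sum>i<n. \<Sum>j<n. if j = d then if i = a then if b = c then A i j else 0 else 0 else 0)"
    using assms by (intro sum.cong refl) (auto simp: matmul_tensor_def simp flip: sum_distrib_left)
  also have "\<dots> = (if b = c then A a d else 0)"
    using assms(2,5) by (simp add: sum.delta)
  finally show ?thesis .
qed

lemma out_comb_inj:
  assumes "matmul_tensor n L w \<mu> \<eta>" and "\<And>l. l \<in> L \<Longrightarrow> out_comb n w l A = 0" and "i < n" "j < n"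
  shows "A i j = 0"
  using out_comb_contract[OF assms(1) assms(3) assms(3) assms(3) assms(4), of A] assms(2) by simp

text \<open>
  Every product occurring in one of the three combinations imposes two linear conditions on
  \<open>u\<close>, namely that the three values of its right factor be proportional to its three
  coefficients; if they all hold then \<open>u\<close> lies in the kernel of the Koszul map of \<open>A\<close>.
\<close>

lemma koszul_support_bound:
  fixes w :: "nat \<Rightarrow> nat \<Rightarrow> 'l \<Rightarrow> 'a::field"
  assumes F: "finite (UNIV :: 'a set)" and L: "finite L" and tensor: "matmul_tensor n L w \<mu> \<eta>"
    and q: "q \<le> n" and inj: "koszul_inj n q A"
  shows "3 * q * n \<le> 2 * card {l \<in> L. \<exists>i<3. out_comb n w l (A i) \<noteq> 0}"
proof (rule ccontr)
  define J where "J = {l \<in> L. \<exists>i<3. out_comb n w l (A i) \<noteq> 0}"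
  define G where "G l i = out_comb n w l (A i)" for l i
  assume "\<not> 3 * q * n \<le> 2 * card {l \<in> L. \<exists>i<3. out_comb n w l (A i) \<noteq> 0}"
  then have less: "2 * card J < 3 * q * n" unfolding J_def by simp
  have finJ: "finite J" using L unfolding J_def by simp
  have "\<forall>l\<in>J. \<exists>i. i < 3 \<and> G l i \<noteq> 0" unfolding J_def G_def by auto
  from bchoice[OF this] obtain s where s: "\<And>l. l \<in> J \<Longrightarrow> s l < 3 \<and> G l (s l) \<noteq> 0" by blast
  \<comment> \<open>The index \<open>s l\<close> has a nonzero coefficient; comparing each of the
    other two indices with it gives the two conditions for \<open>l\<close>.\<close>
  define E where "E = Sigma J (\<lambda>l. {..<3} - {s l})"
  \<comment> \<open>The unknowns are \<open>n\<close> triples of vectors of length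
    \<open>q\<close>.\<close>
  define I where "I = {..<3::nat} \<times> {..<q} \<times> {..<n}"
  define M where "M = (\<lambda>(l, j) (j', d, c). (if j' = j then G l (s l) * \<eta> l c d else 0)
      - (if j' = s l then G l j * \<eta> l c d else 0))"
  have "card E = (\<Sum>l\<in>J. 2)"
    unfolding E_def using finJ s by (subst card_SigmaI) (auto intro!: sum.cong)
  then have card: "card E < card I" using less by (simp add: I_def)
  have fin: "finite E" "finite I" unfolding E_def I_def using finJ by auto
  obtain u where u: "\<exists>x\<in>I. u x \<noteq> 0" "\<forall>x\<in>E. (\<Sum>y\<in>I. M x y * u y) = 0"
    using underdetermined_system[OF F fin card, of M] by (elim exE conjE) (rule that)
  define h where "h l j = (\<Sum>d<q. \<Sum>c<n. \<eta> l c d * u (j, d, c))" for l j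
  have sum_M: "(\<Sum>y\<in>I. M (l, j) y * u y) = G l (s l) * h l j - G l j * h l (s l)"
    if "l \<in> J" "j < 3" for l j
  proof -
    have pick: "(\<Sum>j'<3. \<Sum>d<q. \<Sum>c<n. if j' = m then f j' d c else 0) = (\<Sum>d<q. \<Sum>c<n. f m d c)"
      if "m < 3" for m :: nat and f :: "nat \<Rightarrow> nat \<Rightarrow> nat \<Rightarrow> 'a"
    proof -
      have "(\<Sum>j'<3. \<Sum>d<q. \<Sum>c<n. if j' = m then f j' d c else 0) =
          (\<Sum>j'<3. if j' = m then \<Sum>d<q. \<Sum>c<n. f j' d c else 0)"
        by (intro sum.cong) auto
      then show ?thesis using that by (simp add: sum.delta)
    qed
    have "(\<Sum>y\<in>I. M (l, j) y * u y) = (\<Sum>j'<3. \<Sum>d<q. \<Sum>c<n.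
        (if j' = j then G l (s l) * (\<eta> l c d * u (j', d, c)) else 0)
        - (if j' = s l then G l j * (\<eta> l c d * u (j', d, c)) else 0))"
      unfolding I_def sum.cartesian_product'
      by (intro sum.cong refl) (simp add: M_def left_diff_distrib mult.assoc)
    also have "\<dots> = G l (s l) * h l j - G l j * h l (s l)"
      using s[OF that(1)] that(2)
      by (simp add: sum_subtractf pick h_def sum_distrib_left)
    finally show ?thesis .
  qed
  \<comment> \<open>Comparison with \<open>s l\<close> suffices, because the nonzero factor
    \<open>G l (s l)\<close> can be cancelled; outside \<open>J\<close> all coefficients
    vanish.\<close>
  have proportional: "G l i * h l j = G l j * h l i" if l: "l \<in> L" and ij: "i < 3" "j < 3" for l i j
  proof (cases "l \<in> J")
    case False
    then show ?thesis using that unfolding J_def G_def by auto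
  next
    case True
    have *: "G l (s l) * h l m = G l m * h l (s l)" if "m < 3" for m
    proof (cases "m = s l")
      case False
      then have "(l, m) \<in> E" using True that unfolding E_def by auto
      then show ?thesis using u(2) sum_M[OF True that] by simp
    qed simp
    have "G l (s l) * (G l i * h l j) = G l (s l) * (G l j * h l i)"
      by (simp only: mult.left_commute[of "G l (s l)"] *[OF ij(1)] *[OF ij(2)]) (simp only: mult.left_commute)
    then show ?thesis using s[OF True] by simp
  qed
  have apply_A: "(\<Sum>d<q. A i r d * u (j, d, b)) = (\<Sum>l\<in>L. \<mu> l r b * (G l i * h l j))"
    if "r < n" "b < n" for i j r b
  proof -
    have "(\<Sum>l\<in>L. \<mu> l r b * (G l i * h l j)) =
        (\<Sum>l\<in>L. \<Sum>d<q. \<Sum>c<n. G l i * (\<mu> l r b * \<eta> l c d) * u (j, d, c))"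
      by (simp add: h_def sum_distrib_left mult_ac)
    also have "\<dots> = (\<Sum>d<q. \<Sum>l\<in>L. \<Sum>c<n. G l i * (\<mu> l r b * \<eta> l c d) * u (j, d, c))"
      by (rule sum.swap)
    also have "\<dots> = (\<Sum>d<q. \<Sum>c<n. \<Sum>l\<in>L. G l i * (\<mu> l r b * \<eta> l c d) * u (j, d, c))"
      by (intro sum.cong refl sum.swap)
    also have "\<dots> = (\<Sum>d<q. \<Sum>c<n. if b = c then A i r d * u (j, d, c) else 0)"
    proof (intro sum.cong refl)
      fix d c assume "d \<in> {..<q}" "c \<in> {..<n}"
      then have "d < n" "c < n" using q by auto
      then have "(\<Sum>l\<in>L. G l i * (\<mu> l r b * \<eta> l c d)) = (if b = c then A i r d else 0)"
        unfolding G_def using that by (intro out_comb_contract[OF tensor])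
      then show "(\<Sum>l\<in>L. G l i * (\<mu> l r b * \<eta> l c d) * u (j, d, c)) =
          (if b = c then A i r d * u (j, d, c) else 0)"
        by (simp flip: sum_distrib_right)
    qed
    also have "\<dots> = (\<Sum>d<q. A i r d * u (j, d, b))" using that by (simp add: sum.delta')
    finally show ?thesis ..
  qed
  \<comment> \<open>For each fixed \<open>b\<close> the corresponding slice of \<open>u\<close>
    satisfies the Koszul equations of \<open>A\<close>.\<close>
  have "u (j, d, b) = 0" if "j < 3" "d < q" "b < n" for j d b
  proof -
    have "\<forall>i<3. \<forall>j<3. \<forall>r<n. (\<Sum>d<q. A i r d * u (j, d, b)) = (\<Sum>d<q. A j r d * u (i, d, b))"
      using apply_A[OF _ that(3)] proportional by (auto intro!: sum.cong)
    then show ?thesis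
      using inj[unfolded koszul_inj_def, rule_format, of "\<lambda>j d. u (j, d, b)"] that by blast
  qed
  then show False using u(1) unfolding I_def by auto
qed

section \<open>Counting polynomials of bounded degree and independent triples\<close>

definition polys_below :: "nat \<Rightarrow> 'a::zero poly set"
  where "polys_below k = {a. \<forall>i\<ge>k. coeff a i = 0}"

lemma card_polys_below:
  assumes "finite (UNIV :: 'a::zero set)"
  shows "finite (polys_below k :: 'a poly set) \<and> card (polys_below k :: 'a poly set) = CARD('a) ^ k"
proof (induction k)
  case 0
  have "polys_below 0 = {0 :: 'a poly}" unfolding polys_below_def by (auto intro: poly_eqI)
  then show ?case by simp
next
  case (Suc k)
  have "polys_below (Suc k) = case_prod pCons ` (UNIV \<times> (polys_below k :: 'a poly set))"
  proof (intro equalityI subsetI)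
    fix a :: "'a poly" assume a: "a \<in> polys_below (Suc k)"
    obtain c b where cb: "a = pCons c b" by (cases a)
    have "coeff b i = 0" if "k \<le> i" for i
      using a that unfolding polys_below_def cb by (auto dest!: spec[of _ "Suc i"])
    then show "a \<in> case_prod pCons ` (UNIV \<times> polys_below k)" unfolding polys_below_def cb by auto
  next
    fix a :: "'a poly" assume "a \<in> case_prod pCons ` (UNIV \<times> polys_below k)"
    then show "a \<in> polys_below (Suc k)"
      unfolding polys_below_def by (auto simp: coeff_pCons split: nat.splits)
  qed
  moreover have "inj_on (case_prod pCons) (UNIV \<times> (polys_below k :: 'a poly set))"
    by (auto simp: inj_on_def)
  ultimately show ?case using Suc assms by (simp add: card_image card_cartesian_product)
qed

lemma polys_below_diff: "a \<in> polys_below k \<Longrightarrow> b \<in> polys_below k \<Longrightarrow> a - b \<in> polys_below k"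
  for a :: "'a::comm_ring_1 poly"
  by (simp add: polys_below_def)

lemma degree_polys_below: "a \<in> polys_below k \<Longrightarrow> a \<noteq> 0 \<Longrightarrow> degree a < k"
  unfolding polys_below_def by (metis (mono_tags) leading_coeff_0_iff linorder_not_less mem_Collect_eq)

text \<open>As \<open>f\<close> is additive, subtracting one point of a nonempty fibre maps the
  fibre into the zero set, so none of the \<open>CARD('a)\<close> fibres is larger than that
  set.\<close>

lemma card_kernel_polys_below:
  fixes f :: "'a::field poly \<Rightarrow> 'a"
  assumes F: "finite (UNIV :: 'a set)" and diff: "\<And>a b. f (a - b) = f a - f b"
  shows "CARD('a) ^ k \<le> CARD('a) * card {a \<in> polys_below k. f a = 0}"
proof -
  let ?P = "polys_below k :: 'a poly set" and ?Z = "{a \<in> polys_below k. f a = 0}"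
  have fin: "finite ?P" using card_polys_below[OF F] by blast
  have "card {a \<in> ?P. f a = c} \<le> card ?Z" for c
  proof (cases "{a \<in> ?P. f a = c} = {}")
    case True
    show ?thesis unfolding True by simp
  next
    case False
    then obtain a0 where a0: "a0 \<in> ?P" "f a0 = c" by blast
    show ?thesis
      by (rule card_inj_on_le[of "\<lambda>a. a - a0"])
        (use a0 fin in \<open>auto simp: inj_on_def diff polys_below_diff\<close>)
  qed
  then have "(\<Sum>c\<in>UNIV. card {a \<in> ?P. f a = c}) \<le> (\<Sum>c\<in>(UNIV :: 'a set). card ?Z)"
    by (intro sum_mono)
  moreover have "card ?P = (\<Sum>c\<in>UNIV. card {a \<in> ?P. f a = c})"
    using sum.group[OF fin F, of f "\<lambda>_. 1::nat"] by simp
  ultimately show ?thesis using card_polys_below[OF F, of k] by simp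
qed

definition indep_triples :: "nat \<Rightarrow> ('a::field poly \<times> 'a poly \<times> 'a poly) set"
  where "indep_triples k =
    {(a, b, c). a \<in> polys_below k \<and> b \<in> polys_below k \<and> c \<in> polys_below k \<and> indep3 a b c}"

text \<open>In a dependent triple the last polynomial with nonzero coefficient is a combination of
  the preceding ones. The cases \<open>D1\<close>, \<open>D2\<close>, \<open>D3\<close> allow 1, p
  and p^2 choices of scalars.\<close>

lemma card_indep_triples:
  assumes F: "finite (UNIV :: 'a::field set)"
  defines "p \<equiv> CARD('a)"
  shows "p ^ (3 * k) \<le> card (indep_triples k :: ('a poly \<times> 'a poly \<times> 'a poly) set)
    + (1 + p + p ^ 2) * p ^ (2 * k)"
proof -
  let ?P = "polys_below k :: 'a poly set"
  have fin: "finite ?P" and card: "card ?P = p ^ k" using card_polys_below[OF F, of k] by (auto simp: p_def)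
  define D1 where "D1 = {0 :: 'a poly} \<times> ?P \<times> ?P"
  define D2 where "D2 = (\<lambda>(x, a, c). (a, smult x a, c)) ` ((UNIV :: 'a set) \<times> ?P \<times> ?P)"
  define D3 where "D3 = (\<lambda>(x, y, a, b). (a, b, smult x a + smult y b)) `
    ((UNIV :: 'a set) \<times> (UNIV :: 'a set) \<times> ?P \<times> ?P)"
  have finD: "finite D1" "finite D2" "finite D3" using fin F by (auto simp: D1_def D2_def D3_def)
  have finI: "finite (indep_triples k :: ('a poly \<times> 'a poly \<times> 'a poly) set)"
    by (rule finite_subset[of _ "?P \<times> ?P \<times> ?P"]) (auto simp: indep_triples_def fin)
  have sub: "?P \<times> ?P \<times> ?P \<subseteq> indep_triples k \<union> (D1 \<union> (D2 \<union> D3))"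
  proof
    fix t assume "t \<in> ?P \<times> ?P \<times> ?P"
    then obtain a b c where t: "t = (a, b, c)" and P: "a \<in> ?P" "b \<in> ?P" "c \<in> ?P" by auto
    show "t \<in> indep_triples k \<union> (D1 \<union> (D2 \<union> D3))"
    proof (rule ccontr)
      assume "t \<notin> indep_triples k \<union> (D1 \<union> (D2 \<union> D3))"
      then have abc: "a \<in> ?P" "b \<in> ?P" "c \<in> ?P" "(a, b, c) \<notin> D1 \<union> (D2 \<union> D3)"
        "(a, b, c) \<notin> indep_triples k"
        using t P by auto
      then obtain x y z where xyz: "smult x a + smult y b + smult z c = 0" "x \<noteq> 0 \<or> y \<noteq> 0 \<or> z \<noteq> 0"
        using abc unfolding indep_triples_def indep3_def by blast
      have "z = 0"
      proof (rule ccontr)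
        assume "z \<noteq> 0"
        have "smult z c = smult (- x) a + smult (- y) b"
          using xyz(1) by (simp add: add_eq_0_iff)
        then have "smult (1 / z) (smult z c) = smult (1 / z) (smult (- x) a + smult (- y) b)" by simp
        then have "c = smult (- x / z) a + smult (- y / z) b"
          using \<open>z \<noteq> 0\<close> by (simp add: smult_add_right smult_diff_right)
        then have "(a, b, c) \<in> D3" unfolding D3_def using abc
          by (intro image_eqI[of _ _ "(- x / z, - y / z, a, b)"]) auto
        then show False using abc by blast
      qed
      have "y = 0"
      proof (rule ccontr)
        assume "y \<noteq> 0"
        have "smult y b = smult (- x) a"
          using xyz(1) \<open>z = 0\<close> by (simp add: add_eq_0_iff)
        then have "smult (1 / y) (smult y b) = smult (1 / y) (smult (- x) a)" by simp
        then have "b = smult (- x / y) a" using \<open>y \<noteq> 0\<close> by simp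
        then have "(a, b, c) \<in> D2" unfolding D2_def using abc
          by (intro image_eqI[of _ _ "(- x / y, a, c)"]) auto
        then show False using abc by blast
      qed
      then have "a = 0" using xyz \<open>z = 0\<close> by simp
      then show False using abc unfolding D1_def by blast
    qed
  qed
  have "card (?P \<times> ?P \<times> ?P) \<le> card (indep_triples k \<union> (D1 \<union> (D2 \<union> D3)))"
    using sub finI finD by (intro card_mono) auto
  also have "\<dots> \<le> card (indep_triples k :: ('a poly \<times> 'a poly \<times> 'a poly) set) + (card D1 + (card D2 + card D3))"
    by (meson add_mono card_Un_le le_trans order_refl)
  finally have "p ^ k * (p ^ k * p ^ k) \<le>
      card (indep_triples k :: ('a poly \<times> 'a poly \<times> 'a poly) set) + (card D1 + (card D2 + card D3))"
    by (simp add: card_cartesian_product card)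
  moreover have "card D1 = p ^ k * p ^ k" by (simp add: D1_def card_cartesian_product card)
  moreover have "card D2 \<le> p * (p ^ k * p ^ k)"
    unfolding D2_def by (rule order_trans[OF card_image_le]) (auto simp: fin F card_cartesian_product card p_def)
  moreover have "card D3 \<le> p * (p * (p ^ k * p ^ k))"
    unfolding D3_def by (rule order_trans[OF card_image_le]) (auto simp: fin F card_cartesian_product card p_def)
  ultimately have "p ^ k * (p ^ k * p ^ k) \<le> card (indep_triples k :: ('a poly \<times> 'a poly \<times> 'a poly) set)
      + (p ^ k * p ^ k + (p * (p ^ k * p ^ k) + p * (p * (p ^ k * p ^ k))))"
    by linarith
  moreover have "p ^ (3 * k) = p ^ k * (p ^ k * p ^ k)" "p ^ (2 * k) = p ^ k * p ^ k"
    by (simp_all add: numeral_3_eq_3 mult_2 flip: power_add)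
  ultimately show ?thesis by (simp add: algebra_simps power2_eq_square)
qed

section \<open>Bilinear circuits\<close>

lemma lookup_pconst_mult: "Poly_Mapping.lookup (pconst c * P) m = c * Poly_Mapping.lookup P m"
  by (simp add: pconst_def Poly_Mapping.map.rep_eq when_def flip: mult_map_scale_conv_mult)

definition bimonomial :: "nat \<Rightarrow> nat \<Rightarrow> nat \<Rightarrow> nat \<Rightarrow> matrix_var \<Rightarrow>\<^sub>0 nat"
  where "bimonomial a b c d = Poly_Mapping.single (X a b) 1 + Poly_Mapping.single (Y c d) 1"

lemma bimonomial_eq_iff:
  "bimonomial a b c d = bimonomial a' b' c' d' \<longleftrightarrow> a = a' \<and> b = b' \<and> c = c' \<and> d = d'"
proof
  assume eq: "bimonomial a b c d = bimonomial a' b' c' d'"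
  have "Poly_Mapping.lookup (bimonomial a b c d) (X a b) = 1" "Poly_Mapping.lookup (bimonomial a b c d) (Y c d) = 1"
    by (simp_all add: bimonomial_def lookup_add lookup_single)
  then have "Poly_Mapping.lookup (bimonomial a' b' c' d') (X a b) = 1" "Poly_Mapping.lookup (bimonomial a' b' c' d') (Y c d) = 1"
    using eq by simp_all
  then show "a = a' \<and> b = b' \<and> c = c' \<and> d = d'"
    by (auto simp: bimonomial_def lookup_add lookup_single when_def split: if_splits)
qed simp

lemma lookup_pvar_bimonomial: "Poly_Mapping.lookup (pvar z) (bimonomial a b c d) = 0"
proof -
  have "Poly_Mapping.single z 1 \<noteq> bimonomial a b c d"
  proof
    assume eq: "Poly_Mapping.single z 1 = bimonomial a b c d"
    have "Poly_Mapping.lookup (bimonomial a b c d) (X a b) = 1" "Poly_Mapping.lookup (bimonomial a b c d) (Y c d) = 1"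
      by (simp_all add: bimonomial_def lookup_add lookup_single)
    then show False
      unfolding eq[symmetric] by (auto simp: lookup_single when_def split: if_splits)
  qed
  then show ?thesis by (simp add: pvar_def lookup_single when_def)
qed

lemma lookup_pvar_mult_bimonomial:
  "Poly_Mapping.lookup (pvar (X i k) * pvar (Y k' j)) (bimonomial a b c d) =
    (if a = i \<and> b = k \<and> c = k' \<and> d = j then 1 else 0 :: 'a::comm_ring_1)"
proof -
  have eq: "pvar (X i k) * pvar (Y k' j) = Poly_Mapping.single (bimonomial i k k' j) (1 :: 'a)"
    by (simp add: pvar_def mult_single bimonomial_def)
  show ?thesis unfolding eq by (auto simp: lookup_single when_def bimonomial_eq_iff)
qed

lemma sum_x_vars: "(\<Sum>z\<in>x_vars n. f z) = (\<Sum>i<n. \<Sum>j<n. f (X i j))"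
proof -
  have "x_vars n = case_prod X ` ({..<n} \<times> {..<n})" by (auto simp: x_vars_def)
  moreover have "inj_on (case_prod X) ({..<n} \<times> {..<n})" by (auto simp: inj_on_def)
  ultimately show ?thesis by (simp add: sum.reindex sum.cartesian_product split_def)
qed

lemma sum_y_vars: "(\<Sum>z\<in>y_vars n. f z) = (\<Sum>i<n. \<Sum>j<n. f (Y i j))"
proof -
  have "y_vars n = case_prod Y ` ({..<n} \<times> {..<n})" by (auto simp: y_vars_def)
  moreover have "inj_on (case_prod Y) ({..<n} \<times> {..<n})" by (auto simp: inj_on_def)
  ultimately show ?thesis by (simp add: sum.reindex sum.cartesian_product split_def)
qed

lemma lookup_linear_forms_mult:
  fixes \<alpha> \<beta> :: "matrix_var \<Rightarrow> 'a::comm_ring_1"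
  assumes "a < n" "b < n" "c < n" "d < n"
  shows "Poly_Mapping.lookup ((\<Sum>z\<in>x_vars n. pconst (\<alpha> z) * pvar z) * (\<Sum>z\<in>y_vars n. pconst (\<beta> z) * pvar z))
      (bimonomial a b c d) = \<alpha> (X a b) * \<beta> (Y c d)"
proof -
  have gate_coeff: "Poly_Mapping.lookup ((pconst (\<alpha> (X i j)) * pvar (X i j)) * (pconst (\<beta> (Y k l)) * pvar (Y k l)))
      (bimonomial a b c d) =
      (if j = b then if i = a then if l = d then if k = c then \<alpha> (X i j) * \<beta> (Y k l) else 0 else 0 else 0 else 0)"
    for i j k l
  proof -
    have eq: "(pconst (\<alpha> (X i j)) * pvar (X i j)) * (pconst (\<beta> (Y k l)) * pvar (Y k l)) =
        pconst (\<alpha> (X i j)) * (pconst (\<beta> (Y k l)) * (pvar (X i j) * pvar (Y k l)))"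
      by (simp add: mult_ac)
    show ?thesis unfolding eq by (auto simp: lookup_pconst_mult lookup_pvar_mult_bimonomial)
  qed
  show ?thesis using assms
    by (simp add: sum_x_vars sum_y_vars sum_distrib_left sum_distrib_right lookup_sum gate_coeff sum.delta)
qed

text \<open>By induction along the edges, the coefficients of a node at the bilinear monomials are a
  fixed linear combination of those of the product gates: inputs contribute nothing and sum gates
  combine linearly. The combinations at the output nodes form \<open>w\<close>.\<close>

lemma bilinear_circuit_tensor:
  fixes C :: "('v, matrix_var, 'a::comm_ring_1) circuit"
  assumes bil: "bilinear_circuit n C" and comp: "computes_matrix_product n C"
  defines "L \<equiv> {v \<in> nodes C. label C v = Prod_Gate}"
  shows "\<exists>(w :: nat \<Rightarrow> nat \<Rightarrow> 'v \<Rightarrow> 'a) \<mu> \<eta>. matmul_tensor n L w \<mu> \<eta>"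
proof -
  have circ: "arithmetic_circuit (x_vars n \<union> y_vars n) C" using bil unfolding bilinear_circuit_def by blast
  then have finL: "finite L" unfolding L_def arithmetic_circuit_def by simp
  have "\<exists>\<alpha> \<beta>. node_poly C l =
      (\<Sum>z\<in>x_vars n. pconst (\<alpha> z) * pvar z) * (\<Sum>z\<in>y_vars n. pconst (\<beta> z) * pvar z)" if "l \<in> L" for l
  proof -
    have l: "l \<in> nodes C" "label C l = Prod_Gate" using that unfolding L_def by auto
    obtain P Q where PQ: "map (\<lambda>(c, u). pconst c * node_poly C u) (in_edges C l) = [P, Q]"
      "linear_form (x_vars n) P \<and> linear_form (y_vars n) Q \<or> linear_form (y_vars n) P \<and> linear_form (x_vars n) Q"
      using bil l unfolding bilinear_circuit_def by meson
    have "node_poly C l = P * Q"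
      using node_poly_eq[OF circ l(1)] PQ(1) l(2) by (simp add: gate_poly_def)
    then have "\<exists>P Q. linear_form (x_vars n) P \<and> linear_form (y_vars n) Q \<and> node_poly C l = P * Q"
      using PQ(2) mult.commute[of P Q] by metis
    then show ?thesis unfolding linear_form_def by blast
  qed
  then have "\<forall>l\<in>L. \<exists>f. node_poly C l =
      (\<Sum>z\<in>x_vars n. pconst (fst f z) * pvar z) * (\<Sum>z\<in>y_vars n. pconst (snd f z) * pvar z)"
    by simp
  from bchoice[OF this] obtain f where gate: "\<And>l. l \<in> L \<Longrightarrow> node_poly C l =
      (\<Sum>z\<in>x_vars n. pconst (fst (f l) z) * pvar z) * (\<Sum>z\<in>y_vars n. pconst (snd (f l) z) * pvar z)"
    by blast
  define \<mu> where "\<mu> l a b = fst (f l) (X a b)" for l a b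
  define \<eta> where "\<eta> l c d = snd (f l) (Y c d)" for l c d
  have node: "\<exists>w. \<forall>a<n. \<forall>b<n. \<forall>c<n. \<forall>d<n. Poly_Mapping.lookup (node_poly C v) (bimonomial a b c d) =
      (\<Sum>l\<in>L. w l * (\<mu> l a b * \<eta> l c d))" if "v \<in> nodes C" for v
    using that
  proof (induction v rule: wf_induct_rule[OF wf_edge_rel[OF circ]])
    case (1 v)
    note eq = node_poly_eq[OF circ 1(2)]
    show ?case
    proof (cases "label C v")
      case (Input z)
      then show ?thesis using eq
        by (intro exI[of _ "\<lambda>_. 0"]) (simp add: gate_poly_def lookup_pvar_bimonomial)
    next
      case Prod_Gate
      then have v: "v \<in> L" using 1(2) unfolding L_def by simp
      show ?thesis
      proof (intro exI[of _ "\<lambda>l. if l = v then 1 else 0"] allI impI)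
        fix a b c d assume "a < n" "b < n" "c < n" "d < n"
        then have "Poly_Mapping.lookup (node_poly C v) (bimonomial a b c d) = \<mu> v a b * \<eta> v c d"
          unfolding gate[OF v] \<mu>_def \<eta>_def by (rule lookup_linear_forms_mult)
        also have "\<dots> = (\<Sum>l\<in>L. if l = v then \<mu> l a b * \<eta> l c d else 0)"
          using v finL by (simp add: sum.delta)
        also have "\<dots> = (\<Sum>l\<in>L. (if l = v then 1 else 0) * (\<mu> l a b * \<eta> l c d))"
          by (intro sum.cong) auto
        finally show "Poly_Mapping.lookup (node_poly C v) (bimonomial a b c d) =
            (\<Sum>l\<in>L. (if l = v then 1 else 0) * (\<mu> l a b * \<eta> l c d))" .
      qed
    next
      case Sum_Gate
      \<comment> \<open>Induction over a list of actual incoming edges, so that the outer hypothesis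
        covers their sources.\<close>
      have "\<exists>w. \<forall>a<n. \<forall>b<n. \<forall>c<n. \<forall>d<n.
          Poly_Mapping.lookup (\<Sum>(c, u)\<leftarrow>es. pconst c * node_poly C u) (bimonomial a b c d) =
          (\<Sum>l\<in>L. w l * (\<mu> l a b * \<eta> l c d))" if "set es \<subseteq> set (in_edges C v)" for es
        using that
      proof (induction es)
        case Nil
        show ?case by (intro exI[of _ "\<lambda>_. 0"]) simp
      next
        case (Cons e es)
        obtain s u where e: "e = (s, u)" by (cases e)
        then have "(u, v) \<in> edge_rel C" using Cons.prems 1(2) unfolding edge_rel_def by force
        moreover from this have "u \<in> nodes C" using circ unfolding arithmetic_circuit_def by blast
        ultimately obtain w1 where w1: "\<forall>a<n. \<forall>b<n. \<forall>c<n. \<forall>d<n.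
            Poly_Mapping.lookup (node_poly C u) (bimonomial a b c d) = (\<Sum>l\<in>L. w1 l * (\<mu> l a b * \<eta> l c d))"
          using 1(1) by blast
        obtain w2 where w2: "\<forall>a<n. \<forall>b<n. \<forall>c<n. \<forall>d<n.
            Poly_Mapping.lookup (\<Sum>(c, u)\<leftarrow>es. pconst c * node_poly C u) (bimonomial a b c d) =
            (\<Sum>l\<in>L. w2 l * (\<mu> l a b * \<eta> l c d))"
          using Cons by auto
        show ?case
          by (intro exI[of _ "\<lambda>l. s * w1 l + w2 l"])
            (simp add: e lookup_add lookup_pconst_mult w1 w2 distrib_right sum.distrib sum_distrib_left mult.assoc)
      qed
      from this[of "in_edges C v"] show ?thesis using eq Sum_Gate by (simp add: gate_poly_def)
    qed
  qed
  have "\<exists>w. \<forall>a<n. \<forall>b<n. \<forall>c<n. \<forall>d<n.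
      (\<Sum>l\<in>L. w l * (\<mu> l a b * \<eta> l c d)) = (if a = i \<and> d = j \<and> b = c then 1 else 0)"
    if ij: "i < n" "j < n" for i j
  proof -
    obtain v where v: "v \<in> nodes C" "node_poly C v = (\<Sum>k<n. pvar (X i k) * pvar (Y k j))"
      using comp ij unfolding computes_matrix_product_def by blast
    have coeff: "Poly_Mapping.lookup (node_poly C v) (bimonomial a b c d) = (if a = i \<and> d = j \<and> b = c then 1 else 0)"
      if "b < n" for a b c d
    proof -
      have "Poly_Mapping.lookup (node_poly C v) (bimonomial a b c d) =
          (\<Sum>k<n. if k = b then if a = i \<and> d = j \<and> b = c then 1 else 0 else 0)"
        unfolding v(2) lookup_sum by (intro sum.cong) (auto simp: lookup_pvar_mult_bimonomial)
      then show ?thesis using that by (simp add: sum.delta)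
    qed
    obtain w where w: "\<forall>a<n. \<forall>b<n. \<forall>c<n. \<forall>d<n. Poly_Mapping.lookup (node_poly C v) (bimonomial a b c d) =
        (\<Sum>l\<in>L. w l * (\<mu> l a b * \<eta> l c d))"
      using node[OF v(1)] by blast
    show ?thesis
      by (intro exI[of _ w] allI impI) (subst coeff[symmetric], assumption, use w in simp)
  qed
  then have "\<forall>ij\<in>{..<n} \<times> {..<n}. \<exists>w. \<forall>a<n. \<forall>b<n. \<forall>c<n. \<forall>d<n.
      (\<Sum>l\<in>L. w l * (\<mu> l a b * \<eta> l c d)) = (if a = fst ij \<and> d = snd ij \<and> b = c then 1 else 0)"
    by force
  from bchoice[OF this] obtain w where w: "\<forall>ij\<in>{..<n} \<times> {..<n}. \<forall>a<n. \<forall>b<n. \<forall>c<n. \<forall>d<n.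
      (\<Sum>l\<in>L. w ij l * (\<mu> l a b * \<eta> l c d)) = (if a = fst ij \<and> d = snd ij \<and> b = c then 1 else 0)"
    by blast
  show ?thesis unfolding matmul_tensor_def
    by (intro exI[of _ "curry w"] exI[of _ \<mu>] exI[of _ \<eta>]) (use w in auto)
qed

section \<open>The lower bound\<close>

lemma out_comb_diff: "out_comb n w l (\<lambda>i j. A i j - B i j) = out_comb n w l A - out_comb n w l B"
  by (simp add: out_comb_def right_diff_distrib sum_subtractf)

text \<open>
  An information set \<open>T\<close> of the code \<open>A \<mapsto> (out_comb n w l A)\<^sub>l\<close> has \<open>n\<^sup>2\<close> elements. Truncating the
  family \<open>dilate_mat\<close> to the coordinates in a small \<open>S \<subseteq> T\<close> makes all the products in \<open>T - S\<close>
  disappear; the remaining products are counted by averaging over the independent triples.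
\<close>

lemma matmul_tensor_bound:
  fixes w :: "nat \<Rightarrow> nat \<Rightarrow> 'l \<Rightarrow> 'a::field"
  assumes F: "finite (UNIV :: 'a set)" and L: "finite L" and tensor: "matmul_tensor n L w \<mu> \<eta>"
    and n: "2 * (e + 3 * k) \<le> n"
  defines "p \<equiv> CARD('a)"
  shows "real (card (indep_triples k :: ('a poly \<times> 'a poly \<times> 'a poly) set)) * real (3 * e * n) * real p ^ 3
    \<le> (real (card L) - real n ^ 2 + real (p ^ (3 * k) * (6 * e))) * (real p ^ (3 * k) * (real p ^ 3 - 1))"
proof -
  let ?P = "polys_below k :: 'a poly set"
  define Ind where "Ind = (indep_triples k :: ('a poly \<times> 'a poly \<times> 'a poly) set)"
  define tr where "tr = (\<lambda>(a, b, c) i. [a, b, c :: 'a poly] ! i)"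
  define V where "V = (dilate_mat e (e + 3 * k) :: 'a poly \<Rightarrow> _)"
  define I where "I = {..<n} \<times> {..<n}"
  define G where "G l = (\<lambda>(i, j). w i j l)" for l
  have finP: "finite ?P" and cardP: "card ?P = p ^ k"
    using card_polys_below[OF F, of k] by (auto simp: p_def)
  have sum_G: "(\<Sum>x\<in>I. G l x * u x) = out_comb n w l (curry u)" for l u
    by (simp add: I_def G_def out_comb_def sum.cartesian_product')
  have "finite I" "card I = n ^ 2" unfolding I_def by (auto simp: power2_eq_square)
  have "\<forall>u. (\<forall>l\<in>L. (\<Sum>x\<in>I. G l x * u x) = 0) \<longrightarrow> (\<forall>x\<in>I. u x = 0)"
  proof (intro allI impI ballI)
    fix u x assume u: "\<forall>l\<in>L. (\<Sum>x\<in>I. G l x * u x) = 0" and x: "x \<in> I"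
    have "curry u (fst x) (snd x) = 0"
    proof (rule out_comb_inj[OF tensor])
      show "out_comb n w l (curry u) = 0" if "l \<in> L" for l
        using u that unfolding sum_G by blast
    qed (use x in \<open>auto simp: I_def\<close>)
    then show "u x = 0" by simp
  qed
  from information_set[OF F L \<open>finite I\<close> this] obtain T b where T: "T \<subseteq> L" "n ^ 2 \<le> card T"
    and dual: "\<forall>s\<in>T. \<forall>t\<in>T. (\<Sum>x\<in>I. G t x * b s x) = (if t = s then 1 else 0)"
    and expand: "\<forall>v. \<forall>x\<in>I. v x = (\<Sum>t\<in>T. (\<Sum>y\<in>I. G t y * v y) * b t x)"
    unfolding \<open>card I = n ^ 2\<close> by (elim exE conjE) (rule that)
  have finT: "finite T" using T(1) L finite_subset by blast
  \<comment> \<open>The coordinates of the family at \<open>T\<close>; \<open>v S\<close> keeps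
    those in \<open>S\<close>, and \<open>v T\<close> agrees with \<open>V\<close> on the n x n
    entries.\<close>
  define \<gamma> where "\<gamma> t a = out_comb n w t (V a)" for t a
  define v where "v S a r d = (\<Sum>t\<in>S. \<gamma> t a * b t (r, d))" for S a r d
  have v_T: "v T a r d = V a r d" if "r < n" "d < n" for a r d
    using bspec[OF spec[OF expand, of "case_prod (V a)"], of "(r, d)"] that
    by (simp add: v_def \<gamma>_def sum_G) (simp add: I_def)
  have "\<gamma> t (a - c) = \<gamma> t a - \<gamma> t c" for t a c
    by (simp add: \<gamma>_def V_def dilate_mat_diff flip: out_comb_diff)
  then have v_diff: "v S (a - c) = (\<lambda>r d. v S a r d - v S c r d)" for S a c
    by (simp add: v_def left_diff_distrib sum_subtractf fun_eq_iff)
  have finInd: "finite Ind" and cardInd: "card Ind \<le> p ^ (3 * k)"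
  proof -
    have sub: "Ind \<subseteq> ?P \<times> ?P \<times> ?P" unfolding Ind_def indep_triples_def by auto
    show "finite Ind" by (rule finite_subset[OF sub]) (simp add: finP)
    have "card Ind \<le> card (?P \<times> ?P \<times> ?P)" by (rule card_mono[OF _ sub]) (simp add: finP)
    then show "card Ind \<le> p ^ (3 * k)"
      by (simp add: card_cartesian_product cardP numeral_3_eq_3 flip: power_add)
  qed
  have "\<exists>g :: 'l set \<Rightarrow> 'a. cube_poly T (3 * (2 * e)) g \<and> g T \<noteq> 0 \<and>
      (\<forall>S. g S \<noteq> 0 \<longrightarrow> koszul_inj n (2 * e) (\<lambda>i. v S (tr \<tau> i)))" if "\<tau> \<in> Ind" for \<tau>
  proof -
    have "koszul_inj n (2 * e) (\<lambda>i. V (tr \<tau> i))"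
      unfolding V_def
    proof (rule koszul_inj_dilate_mat[OF _ _ n])
      show ind: "indep3 (tr \<tau> 0) (tr \<tau> 1) (tr \<tau> 2)"
        using that unfolding Ind_def indep_triples_def tr_def by auto
      have "\<forall>i<3. tr \<tau> i \<in> ?P \<and> tr \<tau> i \<noteq> 0"
        using that indep3_nonzero[OF ind] indep3_nonzero[OF indep3_rotate[OF ind]]
          indep3_nonzero[OF indep3_rotate[OF indep3_rotate[OF ind]]]
        unfolding all_less_3 by (auto simp: Ind_def indep_triples_def tr_def)
      then show "degree (tr \<tau> i) < k" if "i < 3" for i
        using that degree_polys_below by blast
    qed
    then have "koszul_inj n (2 * e) (\<lambda>i. v T (tr \<tau> i))"
      by (rule koszul_inj_cong[rotated]) (use n in \<open>simp add: v_T\<close>)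
    then show ?thesis unfolding v_def by (rule koszul_inj_cube_poly[OF F finT])
  qed
  then have "\<forall>\<tau>\<in>Ind. \<exists>g :: 'l set \<Rightarrow> 'a. cube_poly T (3 * (2 * e)) g \<and> g T \<noteq> 0 \<and>
      (\<forall>S. g S \<noteq> 0 \<longrightarrow> koszul_inj n (2 * e) (\<lambda>i. v S (tr \<tau> i)))" by blast
  from bchoice[OF this] obtain g :: "_ \<Rightarrow> 'l set \<Rightarrow> 'a"
    where g: "\<And>\<tau>. \<tau> \<in> Ind \<Longrightarrow> cube_poly T (3 * (2 * e)) (g \<tau>) \<and> g \<tau> T \<noteq> 0 \<and>
      (\<forall>S. g \<tau> S \<noteq> 0 \<longrightarrow> koszul_inj n (2 * e) (\<lambda>i. v S (tr \<tau> i)))"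
    by blast
  \<comment> \<open>Multiplying the polynomials of all triples produces one set \<open>S\<close>
    that serves every triple at once.\<close>
  have "cube_poly T (card Ind * (3 * (2 * e))) (\<lambda>S. \<Prod>\<tau>\<in>Ind. g \<tau> S)"
    using g by (intro cube_poly_prod finT finInd) blast
  moreover have "(\<Prod>\<tau>\<in>Ind. g \<tau> T) \<noteq> 0" using g finInd by simp
  ultimately obtain S where S: "S \<subseteq> T" "card S \<le> card Ind * (3 * (2 * e))" "(\<Prod>\<tau>\<in>Ind. g \<tau> S) \<noteq> 0"
    using cube_poly_nonzero_small[OF finT] by blast
  have finS: "finite S" using S(1) finT finite_subset by blast
  have inj_S: "koszul_inj n (2 * e) (\<lambda>i. v S (tr \<tau> i))" if "\<tau> \<in> Ind" for \<tau>
    using S(3) finInd g[OF that] that by simp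
  have "card S \<le> card Ind * (6 * e)" using S(2) by simp
  also have "\<dots> \<le> p ^ (3 * k) * (6 * e)" using cardInd by (rule mult_right_mono) simp
  finally have card_S: "card S \<le> p ^ (3 * k) * (6 * e)" .
  \<comment> \<open>The products that may still occur after truncation to \<open>S\<close>;
    \<open>vanish\<close> below excludes the others by duality.\<close>
  define M where "M = L - (T - S)"
  have finM: "finite M" unfolding M_def using L by simp
  have card_M: "real (card M) \<le> real (card L) - real n ^ 2 + real (p ^ (3 * k) * (6 * e))"
  proof -
    have TS: "T - S \<subseteq> L" using T(1) by blast
    have "card M = card L - card (T - S)" unfolding M_def using finT TS by (simp add: card_Diff_subset)
    moreover have "card (T - S) \<le> card L" using TS L by (rule card_mono[rotated])
    moreover have "card (T - S) = card T - card S" using S(1) finS by (simp add: card_Diff_subset)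
    moreover have "card S \<le> card T" using S(1) finT by (rule card_mono[rotated])
    ultimately have "real (card M) = real (card L) - (real (card T) - real (card S))" by simp
    moreover have "real n ^ 2 \<le> real (card T)" using T(2) by (metis of_nat_le_iff of_nat_power)
    moreover have "real (card S) \<le> real (p ^ (3 * k) * (6 * e))"
      using card_S by (rule of_nat_mono)
    ultimately show ?thesis by linarith
  qed
  have vanish: "out_comb n w l (v S a) = 0" if "l \<in> T - S" for l a
  proof -
    have "out_comb n w l (v S a) = (\<Sum>x\<in>I. G l x * (\<Sum>t\<in>S. \<gamma> t a * b t x))"
      by (simp add: sum_G curry_def flip: v_def)
    also have "\<dots> = (\<Sum>x\<in>I. \<Sum>t\<in>S. \<gamma> t a * (G l x * b t x))"
      by (simp add: sum_distrib_left mult_ac)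
    also have "\<dots> = (\<Sum>t\<in>S. \<gamma> t a * (\<Sum>x\<in>I. G l x * b t x))"
      by (subst sum.swap) (simp add: sum_distrib_left)
    also have "\<dots> = 0"
    proof (intro sum.neutral ballI)
      fix t assume "t \<in> S"
      then have "(\<Sum>x\<in>I. G l x * b t x) = 0" using dual that S(1) by fastforce
      then show "\<gamma> t a * (\<Sum>x\<in>I. G l x * b t x) = 0" by simp
    qed
    finally show ?thesis .
  qed
  define J where "J \<tau> = {l \<in> L. \<exists>i<3. out_comb n w l (v S (tr \<tau> i)) \<noteq> 0}" for \<tau>
  have J_sub: "J \<tau> \<subseteq> M" for \<tau> unfolding J_def M_def using vanish by blast
  \<comment> \<open>With \<open>2 * e\<close> columns the support bound carries a factor 2 on both
    sides.\<close>
  have "3 * e * n \<le> card (J \<tau>)" if "\<tau> \<in> Ind" for \<tau>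
    using koszul_support_bound[OF F L tensor _ inj_S[OF that]] n unfolding J_def by simp
  \<comment> \<open>Double counting of the pairs of a triple and a product occurring in it.\<close>
  then have "card Ind * (3 * e * n) \<le> (\<Sum>\<tau>\<in>Ind. card (J \<tau>))"
    using sum_mono[of Ind "\<lambda>_. 3 * e * n" "\<lambda>\<tau>. card (J \<tau>)"] by simp
  also have "\<dots> = (\<Sum>\<tau>\<in>Ind. \<Sum>l\<in>M. if l \<in> J \<tau> then 1 else 0)"
  proof (rule sum.cong[OF refl])
    fix \<tau>
    have "M \<inter> J \<tau> = J \<tau>" using J_sub by blast
    then show "card (J \<tau>) = (\<Sum>l\<in>M. if l \<in> J \<tau> then 1 else 0)"
      using finM by (simp add: sum.If_cases Int_def[symmetric])
  qed
  also have "\<dots> = (\<Sum>l\<in>M. \<Sum>\<tau>\<in>Ind. if l \<in> J \<tau> then 1 else 0)" by (rule sum.swap)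
  also have "\<dots> = (\<Sum>l\<in>M. card {\<tau> \<in> Ind. l \<in> J \<tau>})"
    using finInd by (intro sum.cong refl) (simp add: sum.If_cases Int_def)
  finally have count: "card Ind * (3 * e * n) \<le> (\<Sum>l\<in>M. card {\<tau> \<in> Ind. l \<in> J \<tau>})" .
  \<comment> \<open>At least a fraction 1/p of the polynomials lies in the kernel \<open>Z\<close>
    of the coefficient of \<open>l\<close>, and a triple from \<open>Z\<close> misses
    \<open>l\<close>.\<close>
  have fibre: "real p ^ 3 * real (card {\<tau> \<in> Ind. l \<in> J \<tau>}) \<le> real p ^ (3 * k) * (real p ^ 3 - 1)" for l
  proof -
    define Z where "Z = {a \<in> ?P. out_comb n w l (v S a) = 0}"
    have finZ: "finite Z" unfolding Z_def using finP by simp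
    have "p ^ k \<le> p * card Z"
      unfolding p_def Z_def by (rule card_kernel_polys_below[OF F]) (simp add: v_diff out_comb_diff)
    then have "real (p ^ k) \<le> real (p * card Z)" by (rule of_nat_mono)
    then have "real (p ^ k) ^ 3 \<le> real (p * card Z) ^ 3" by (rule power_mono) simp
    moreover have "real (p ^ k) ^ 3 = real p ^ (3 * k)"
      by (simp only: of_nat_power power_mult[symmetric] mult.commute)
    ultimately have Z3: "real p ^ (3 * k) \<le> real p ^ 3 * real (card Z) ^ 3"
      by (simp only: of_nat_mult power_mult_distrib)
    have ZP: "Z \<times> Z \<times> Z \<subseteq> ?P \<times> ?P \<times> ?P" unfolding Z_def by auto
    have "{\<tau> \<in> Ind. l \<in> J \<tau>} \<subseteq> ?P \<times> ?P \<times> ?P - Z \<times> Z \<times> Z"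
    proof clarify
      fix a c d assume \<tau>: "(a, c, d) \<in> Ind" "l \<in> J (a, c, d)"
      have "\<not> (\<forall>i<3. out_comb n w l (v S (tr (a, c, d) i)) = 0)" using \<tau>(2) unfolding J_def by blast
      then have "\<not> (a \<in> Z \<and> c \<in> Z \<and> d \<in> Z)" unfolding all_less_3 tr_def Z_def by auto
      then show "(a, c, d) \<in> ?P \<times> ?P \<times> ?P - Z \<times> Z \<times> Z"
        using \<tau>(1) unfolding Ind_def indep_triples_def by auto
    qed
    then have "card {\<tau> \<in> Ind. l \<in> J \<tau>} \<le> card (?P \<times> ?P \<times> ?P - Z \<times> Z \<times> Z)"
      by (intro card_mono) (auto simp: finP)
    also have "\<dots> = card (?P \<times> ?P \<times> ?P) - card (Z \<times> Z \<times> Z)"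
      using ZP by (intro card_Diff_subset) (auto simp: finZ)
    finally have "real (card {\<tau> \<in> Ind. l \<in> J \<tau>}) \<le> real (card (?P \<times> ?P \<times> ?P) - card (Z \<times> Z \<times> Z))"
      by (rule of_nat_mono)
    also have "\<dots> = real (card (?P \<times> ?P \<times> ?P)) - real (card (Z \<times> Z \<times> Z))"
      using ZP by (intro of_nat_diff card_mono) (auto simp: finP)
    also have "\<dots> = real p ^ (3 * k) - real (card Z) ^ 3"
      by (simp add: card_cartesian_product cardP power3_eq_cube mult.assoc) (simp add: numeral_3_eq_3 power_add)
    finally have "real p ^ 3 * real (card {\<tau> \<in> Ind. l \<in> J \<tau>}) \<le> real p ^ 3 * (real p ^ (3 * k) - real (card Z) ^ 3)"
      by (rule mult_left_mono) simp
    then show ?thesis using Z3 by (simp add: algebra_simps)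
  qed
  have "real (card Ind) * real (3 * e * n) * real p ^ 3 \<le> real p ^ 3 * real (\<Sum>l\<in>M. card {\<tau> \<in> Ind. l \<in> J \<tau>})"
    using mult_left_mono[OF of_nat_mono[OF count], of "real p ^ 3"] by (simp add: mult_ac)
  also have "\<dots> = (\<Sum>l\<in>M. real p ^ 3 * real (card {\<tau> \<in> Ind. l \<in> J \<tau>}))"
    by (simp add: sum_distrib_left)
  also have "\<dots> \<le> (\<Sum>l\<in>M. real p ^ (3 * k) * (real p ^ 3 - 1))"
    by (rule sum_mono[OF fibre])
  also have "\<dots> = real (card M) * (real p ^ (3 * k) * (real p ^ 3 - 1))" by simp
  also have "\<dots> \<le> (real (card L) - real n ^ 2 + real (p ^ (3 * k) * (6 * e))) * (real p ^ (3 * k) * (real p ^ 3 - 1))"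
  proof (rule mult_right_mono[OF card_M])
    have "1 \<le> p" unfolding p_def using F by (simp add: Suc_le_eq card_gt_0_iff)
    then show "0 \<le> real p ^ (3 * k) * (real p ^ 3 - 1)" by (simp add: one_le_power)
  qed
  finally show ?thesis unfolding Ind_def .
qed

section \<open>Numerical estimates\<close>

lemma six_mult_le_power: "6 * k \<le> (16 :: nat) ^ k"
proof (induction k)
  case (Suc k)
  have "1 \<le> (16 :: nat) ^ k" by simp
  then have "6 + 6 * k \<le> 16 ^ k + 15 * 16 ^ k" using Suc by linarith
  then show ?case by simp
qed simp

text \<open>Meant for \<open>q\<close> = p^k and \<open>y\<close> = n^(1/4), with \<open>m\<close>
  products and \<open>t\<close> independent triples. The sacrificed coordinates cost at most 3 y^7,
  the dependent triples 3 c p y^7, and the gap between \<open>2 * e\<close> and \<open>n\<close> at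
  most 21 y^7.\<close>

lemma gate_count_arith:
  fixes p y n m t e k R q c :: real
  assumes p: "2 \<le> p" and R: "R = p ^ 3" and y: "1 \<le> y" and n: "n = y ^ 4"
    and q: "q \<le> y" "y \<le> p * q" "0 < q" and k: "0 \<le> k" "k \<le> q"
    and e: "0 \<le> e" "2 * e \<le> n" "n - 6 * k - 1 \<le> 2 * e"
    and c: "0 \<le> c" and t: "q ^ 3 - c * q ^ 2 \<le> t"
    and bound: "t * (3 * e * n) * R \<le> (m - n ^ 2 + q ^ 3 * (6 * e)) * (q ^ 3 * (R - 1))"
  shows "(2.5 + 1.5 / (R - 1)) * n ^ 2 - (24 + 3 * c * p) * y ^ 7 \<le> m"
proof -
  \<comment> \<open>The gain p^3 / (p^3 - 1) from averaging; \<open>1 + 1.5 * \<rho>\<close> is the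
    leading coefficient of the bound.\<close>
  define \<rho> where "\<rho> = R / (R - 1)"
  have "2 ^ 3 \<le> p ^ 3" using p by (intro power_mono) auto
  then have R8: "8 \<le> R" using R by simp
  then have rho: "1 \<le> \<rho>" "\<rho> \<le> 2" "1.5 * \<rho> = 1.5 + 1.5 / (R - 1)" by (auto simp: \<rho>_def field_simps)
  have n0: "0 \<le> n" using n y by simp
  have q30: "0 < q ^ 3 * (R - 1)" using q R8 by simp
  have "(q ^ 3 - c * q ^ 2) * (3 * e * n) * R \<le> t * (3 * e * n) * R"
    using t e n0 R8 by (intro mult_right_mono) auto
  also note bound
  finally have "(q ^ 3 - c * q ^ 2) * (3 * e * n) * R / (q ^ 3 * (R - 1)) \<le> m - n ^ 2 + q ^ 3 * (6 * e)"
    using q30 by (simp add: pos_divide_le_eq)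
  moreover have "(q ^ 3 - c * q ^ 2) * (3 * e * n) * R / (q ^ 3 * (R - 1)) = 3 * e * n * \<rho> - 3 * e * n * \<rho> * (c / q)"
  proof -
    have "(q ^ 3 - c * q ^ 2) * (3 * e * n) * R / (q ^ 3 * (R - 1)) = 3 * e * n * \<rho> * ((q ^ 3 - c * q ^ 2) / q ^ 3)"
      unfolding \<rho>_def by (simp add: mult.commute mult.left_commute)
    also have "(q ^ 3 - c * q ^ 2) / q ^ 3 = 1 - c / q"
      using q(3) by (simp add: field_simps power3_eq_cube power2_eq_square)
    finally show ?thesis by (simp add: right_diff_distrib)
  qed
  ultimately have m: "n ^ 2 + 3 * e * n * \<rho> - 3 * e * n * \<rho> * (c / q) - q ^ 3 * (6 * e) \<le> m" by linarith
  have 1: "q ^ 3 * (6 * e) \<le> 3 * y ^ 7"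
  proof -
    have e6: "6 * e \<le> 3 * y ^ 4" using e(2) n by linarith
    have q3: "q ^ 3 \<le> y ^ 3" using q by (intro power_mono) auto
    have "q ^ 3 * (6 * e) \<le> y ^ 3 * (3 * y ^ 4)" by (rule mult_mono[OF q3 e6]) (use e y in auto)
    then show ?thesis by (simp flip: power_add)
  qed
  have 2: "3 * e * n * \<rho> * (c / q) \<le> 3 * c * p * y ^ 7"
  proof -
    have "c / q \<le> c * p / y"
      using q(2,3) y c mult_left_mono[OF q(2), of c] by (simp add: field_simps)
    moreover have "3 * e * n * \<rho> \<le> (3 / 2 * n) * n * 2"
    proof -
      have "3 * e * n \<le> (3 / 2 * n) * n" using e n0 by (intro mult_right_mono) auto
      then show ?thesis by (rule mult_mono) (use rho n0 in auto)
    qed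
    ultimately have "3 * e * n * \<rho> * (c / q) \<le> (3 / 2 * n * n * 2) * (c * p / y)"
      by (intro mult_mono[of "3 * e * n * \<rho>"]) (use c q n0 in auto)
    also have "\<dots> = 3 * c * p * y ^ 7"
      using y unfolding n by (simp add: field_simps flip: power_add power_Suc)
    finally show ?thesis .
  qed
  have 3: "1.5 * \<rho> * n ^ 2 - 21 * y ^ 7 \<le> 3 * e * n * \<rho>"
  proof -
    have "k * n \<le> y * y ^ 4" using k q n y by (intro mult_mono) auto
    also have "\<dots> \<le> y ^ 7" using power_increasing[of 5 7 y] y by (simp flip: power_Suc)
    finally have kn: "k * n \<le> y ^ 7" .
    have n7: "n \<le> y ^ 7" using power_increasing[of 4 7 y] y n by simp
    have kn7: "(6 * k + 1) * n \<le> 7 * y ^ 7" using kn n7 by (simp add: algebra_simps)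
    have "1.5 * \<rho> * ((6 * k + 1) * n) \<le> 3 * (7 * y ^ 7)"
      by (rule mult_mono[OF _ kn7]) (use rho k n0 in auto)
    moreover have "1.5 * \<rho> * n * (n - 6 * k - 1) \<le> 1.5 * \<rho> * n * (2 * e)"
      using e rho n0 by (intro mult_left_mono) auto
    ultimately show ?thesis by (simp add: algebra_simps power2_eq_square)
  qed
  have "(2.5 + 1.5 / (R - 1)) * n ^ 2 = n ^ 2 + 1.5 * \<rho> * n ^ 2"
    unfolding rho(3) by (simp add: algebra_simps)
  then show ?thesis using m 1 2 3 by (simp add: algebra_simps)
qed

theorem theorem4:
  fixes p :: nat
  assumes "prime p"
    and "CARD('a::field) = p"
  shows "\<exists>K::real. \<forall>n\<ge>1. \<forall>C :: (nat, matrix_var, 'a) circuit.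
    bilinear_circuit n C \<and> computes_matrix_product n C \<longrightarrow>
      real (num_product_gates C) \<ge>
        (2.5 + 1.5 / (real p ^ 3 - 1)) * real n ^ 2 - K * real n powr (7 / 4)"
proof -
  define c where "c = 1 + real p + real p ^ 2"
  have p2: "2 \<le> p" using assms(1) by (rule prime_ge_2_nat)
  have F: "finite (UNIV :: 'a set)" using assms(2) p2 by (intro card_ge_0_finite) simp
  \<comment> \<open>The witness \<open>24 + 3 * c * real p\<close> is the error constant of
    \<open>gate_count_arith\<close>, with \<open>c\<close> the factor from
    \<open>card_indep_triples\<close>.\<close>
  have "(2.5 + 1.5 / (real p ^ 3 - 1)) * real n ^ 2 - (24 + 3 * c * real p) * real n powr (7 / 4)
      \<le> real (num_product_gates C)"
    if n1: "1 \<le> n" and C: "bilinear_circuit n C" "computes_matrix_product n C"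
    for n and C :: "(nat, matrix_var, 'a) circuit"
  proof -
    define y where "y = real n powr (1 / 4)"
    have y1: "1 \<le> y" unfolding y_def using n1 by (simp add: ge_one_powr_ge_zero)
    have y_power: "y ^ j = real n powr (real j / 4)" for j
      using n1 by (simp add: y_def powr_power)
    \<comment> \<open>The largest \<open>k\<close> with p^k at most n^(1/4), which leaves the two
      within a factor p of each other.\<close>
    obtain k where k: "real p ^ k \<le> y" "y < real p ^ Suc k"
    proof -
      define k where "k = (LEAST j. y < real p ^ Suc j)"
      obtain j where j: "y < real p ^ j" using real_arch_pow[of "real p" y] p2 by auto
      also have "real p ^ j \<le> real p ^ Suc j" using p2 by (intro power_increasing) auto
      finally have up: "y < real p ^ Suc k" unfolding k_def by (rule LeastI)
      have "real p ^ k \<le> y"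
      proof (cases k)
        case (Suc i)
        then have "\<not> y < real p ^ Suc i" unfolding k_def by (intro not_less_Least) simp
        then show ?thesis using Suc by simp
      qed (use y1 in simp)
      with up show thesis by (rule that[rotated])
    qed
    define L where "L = {v \<in> nodes C. label C v = Prod_Gate}"
    have finL: "finite L"
      using C(1) unfolding L_def bilinear_circuit_def arithmetic_circuit_def by simp
    obtain w :: "nat \<Rightarrow> nat \<Rightarrow> nat \<Rightarrow> 'a" and \<mu> \<eta> where tensor: "matmul_tensor n L w \<mu> \<eta>"
      using bilinear_circuit_tensor[OF C] unfolding L_def by blast
    \<comment> \<open>Follows from 16^k \<le> p^(4k) \<le> n, and keeps the subtraction in
      \<open>e\<close> below from being truncated.\<close>
    have "6 * k \<le> n"
    proof -
      have "real (16 ^ k) = (2 ^ k) ^ 4" by (simp add: power_mult[symmetric] mult.commute[of k] power_mult)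
      also have "\<dots> \<le> (real p ^ k) ^ 4" using p2 by (intro power_mono) auto
      also have "\<dots> \<le> y ^ 4" using k(1) by (intro power_mono) auto
      also have "\<dots> = real n" using y_power[of 4] by simp
      finally show ?thesis using six_mult_le_power[of k] by linarith
    qed
    \<comment> \<open>The largest \<open>e\<close> that satisfies
      \<open>2 * (e + 3 * k) \<le> n\<close>; halving loses at most one column.\<close>
    define e where "e = (n - 6 * k) div 2"
    have e: "2 * (e + 3 * k) \<le> n" "n \<le> 2 * e + 6 * k + 1" using \<open>6 * k \<le> n\<close> unfolding e_def by auto
    define t where "t = card (indep_triples k :: ('a poly \<times> 'a poly \<times> 'a poly) set)"
    have pk: "(real p ^ k) ^ 3 = real p ^ (3 * k)" "(real p ^ k) ^ 2 = real p ^ (2 * k)"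
      by (simp_all only: power_mult[symmetric] mult.commute)
    have t: "(real p ^ k) ^ 3 - c * (real p ^ k) ^ 2 \<le> real t"
    proof -
      have "real (p ^ (3 * k)) \<le> real (t + (1 + p + p ^ 2) * p ^ (2 * k))"
        using card_indep_triples[OF F, of k] unfolding t_def assms(2) by (rule of_nat_mono)
      then show ?thesis unfolding c_def pk by (simp add: algebra_simps)
    qed
    have bound: "real t * (3 * real e * real n) * real p ^ 3 \<le>
        (real (card L) - real n ^ 2 + (real p ^ k) ^ 3 * (6 * real e)) * ((real p ^ k) ^ 3 * (real p ^ 3 - 1))"
      using matmul_tensor_bound[OF F finL tensor e(1)] unfolding t_def assms(2) pk
      by (simp only: of_nat_mult of_nat_power of_nat_numeral)
    have "(2.5 + 1.5 / (real p ^ 3 - 1)) * real n ^ 2 - (24 + 3 * c * real p) * y ^ 7 \<le> real (card L)"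
    proof (rule gate_count_arith[OF _ refl y1 _ k(1) _ _ _ _ _ _ _ _ t bound])
      show "real k \<le> real p ^ k"
        using less_exp[of k] power_mono[of 2 p k] p2 by (metis le_trans less_imp_le of_nat_le_iff of_nat_power zero_le)
      show "real n = y ^ 4" using y_power[of 4] by simp
    qed (use p2 k e c_def in auto)
    then show ?thesis using y_power[of 7] by (simp add: num_product_gates_def L_def)
  qed
  then show ?thesis by blast
qed

end
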